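(* Let $X$ be a transient random walk on $\mathbf{Z}^d$ started at $X_0=0$, with Green function $g$. Then, with probability one, $$\overline{\mathrm{Dim}}_{\mathrm M}(\mathcal{R}_X)=\gamma_c:=\inf\Big\{\gamma\in(0,d):\ \sum_{x\in\mathbf{Z}^d\setminus\{0\}}\frac{g(0,x)}{\|x\|^\gamma}<\infty\Big\},$$ with the convention $\inf\varnothing:=d$.
   Context: A random walk on $\mathbf{Z}^d$ is $X_n=X_0+\xi_1+\cdots+\xi_n$ with $\xi_1,\xi_2,\dots$ i.i.d. $\mathbf{Z}^d$-valued; $P^a$ denotes its law when $X_0=a$. Its Green function is $g(a,x):=\sum_{n\ge0}P^a\{X_n=x\}$, and transience means $g$ is finite. $\mathcal{R}_X:=\bigcup_{n\ge0}\{X_n\}$ is the range. For $k\ge0$, $\mathcal{V}_k:=[-2^k,2^k)^d$. The macroscopic upper Minkowski dimension of $A\subseteq\mathbf{Z}^d$ is $\overline{\mathrm{Dim}}_{\mathrm M}(A):=\limsup_{n\to\infty}n^{-1}\log_2\#(A\cap\mathcal{V}_n)$. $\|\cdot\|$ is the Euclidean norm. *)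

theory Defs
  imports "HOL-Probability.Probability"
begin

text \<open>Points of Z^d are int vectors indexed by a finite type 'd; d = CARD('d).\<close>

definition eucl_norm :: "int ^ 'd \<Rightarrow> real" where
  "eucl_norm x = sqrt (\<Sum>i\<in>UNIV. (real_of_int (x $ i))^2)"

text \<open>The random walk started at 0: X_n = xi_1 + ... + xi_n (steps indexed from 0 here).\<close>
definition walk :: "(nat \<Rightarrow> 'w \<Rightarrow> int ^ 'd) \<Rightarrow> nat \<Rightarrow> 'w \<Rightarrow> int ^ 'd" where
  "walk \<xi> n \<omega> = (\<Sum>i<n. \<xi> i \<omega>)"

definition green0 :: "'w measure \<Rightarrow> (nat \<Rightarrow> 'w \<Rightarrow> int ^ 'd) \<Rightarrow> int ^ 'd \<Rightarrow> ennreal" where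
  "green0 M \<xi> x = (\<Sum>n. emeasure M {\<omega> \<in> space M. walk \<xi> n \<omega> = x})"

definition range_walk :: "(nat \<Rightarrow> 'w \<Rightarrow> int ^ 'd) \<Rightarrow> 'w \<Rightarrow> (int ^ 'd) set" where
  "range_walk \<xi> \<omega> = (\<Union>n. {walk \<xi> n \<omega>})"

definition cubeV :: "nat \<Rightarrow> (int ^ 'd) set" where
  "cubeV k = {x. \<forall>i. - (2 ^ k) \<le> x $ i \<and> x $ i < 2 ^ k}"

definition upper_mink_dim :: "(int ^ 'd) set \<Rightarrow> ereal" where
  "upper_mink_dim A = limsup (\<lambda>n. ereal (log 2 (real (card (A \<inter> cubeV n))) / real n))"

definition gamma_c :: "'w measure \<Rightarrow> (nat \<Rightarrow> 'w \<Rightarrow> int ^ 'd) \<Rightarrow> real" where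
  "gamma_c M \<xi> =
    (let S = {\<gamma>::real. 0 < \<gamma> \<and> \<gamma> < real CARD('d) \<and>
               (\<integral>\<^sup>+ x. green0 M \<xi> x / ennreal (eucl_norm x powr \<gamma>)
                   \<partial>count_space (UNIV - {0})) < \<top>}
     in if S = {} then real CARD('d) else Inf S)"

end

theory Submission
  imports Defs "HOL-Real_Asymp.Real_Asymp"
begin

text \<open>
  Write \<open>G n\<close> for the Green mass of the cube \<open>V n\<close>. Up to a dyadic decomposition, \<open>\<gamma>_c\<close> is the
  exponential growth rate of \<open>G n\<close>. If the series with exponent \<open>\<gamma>\<close> converges, then the sum of
  \<open>\<parallel>x\<parallel> powr (- \<gamma>)\<close> over the range has finite expectation, and its finiteness bounds the dimension by
  \<open>\<gamma>\<close>. Conversely, let \<open>N n\<close> be the number of points of the range in \<open>V n\<close>. Then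
  \<open>E (N n) \<ge> G n / g 0\<close>, because a point is hit with probability \<open>g x / g 0\<close>, and
  \<open>E ((N n)\<^sup>2) \<le> 2 * G n * G (n + 1)\<close> by the Markov property. The first entrance decomposition of a box
  gives \<open>G (n + 1) \<le> C * G n\<close>, so by the Paley-Zygmund inequality \<open>N n\<close> is comparable to \<open>G n\<close> with
  probability bounded below uniformly in \<open>n\<close>. Hence the lower bound on the dimension holds with
  positive probability, and with probability one by Kolmogorov's zero-one law.
\<close>

subsection \<open>Cubes\<close>

text \<open>Used for the cubes and also for the index set of the boxes in the doubling
  estimate.\<close>

lemma finite_card_vec_entries:
  fixes A :: "'a set"
  assumes "finite A"
  shows "finite {x :: 'a ^ 'd. \<forall>i. x $ i \<in> A}"
    and "card {x :: 'a ^ 'd. \<forall>i. x $ i \<in> A} = card A ^ CARD('d)"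
proof -
  have eq: "{x :: 'a ^ 'd. \<forall>i. x $ i \<in> A} = vec_lambda ` (PiE UNIV (\<lambda>_. A))"
  proof safe
    fix x :: "'a ^ 'd" assume "\<forall>i. x $ i \<in> A"
    then have "x = vec_lambda (vec_nth x)" "vec_nth x \<in> PiE UNIV (\<lambda>_. A)"
      by auto
    then show "x \<in> vec_lambda ` (PiE UNIV (\<lambda>_. A))" by blast
  qed auto
  have inj: "inj_on vec_lambda (PiE (UNIV :: 'd set) (\<lambda>_. A))"
    by (auto simp: inj_on_def vec_lambda_inject)
  show "finite {x :: 'a ^ 'd. \<forall>i. x $ i \<in> A}"
    unfolding eq using assms by (intro finite_imageI finite_PiE) auto
  show "card {x :: 'a ^ 'd. \<forall>i. x $ i \<in> A} = card A ^ CARD('d)"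
    unfolding eq card_image[OF inj] by (simp add: card_PiE)
qed

lemma cubeV_altdef: "cubeV n = {x. \<forall>i. x $ i \<in> {- (2 ^ n)..<2 ^ n}}"
  by (auto simp: cubeV_def)

lemma finite_cubeV [simp]: "finite (cubeV n)"
  unfolding cubeV_altdef by (rule finite_card_vec_entries) simp

lemma card_cubeV: "card (cubeV n :: (int ^ 'd) set) = (2 * 2 ^ n) ^ CARD('d)"
  unfolding cubeV_altdef by (subst finite_card_vec_entries) (simp_all add: nat_mult_distrib nat_power_eq)

lemma zero_in_cubeV [simp]: "0 \<in> cubeV n"
  by (simp add: cubeV_def)

lemma cubeV_diff:
  assumes "x \<in> cubeV n" "y \<in> cubeV n"
  shows "x - y \<in> cubeV (Suc n)"
  unfolding cubeV_def
proof safe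
  fix i
  have "- (2 ^ n) \<le> x $ i" "x $ i < 2 ^ n" "- (2 ^ n) \<le> y $ i" "y $ i < 2 ^ n"
    using assms by (auto simp: cubeV_def)
  then show "- (2 ^ Suc n) \<le> (x - y) $ i" "(x - y) $ i < 2 ^ Suc n"
    by simp_all
qed

lemma cubeV_add:
  assumes "x \<in> cubeV n" "y \<in> cubeV n"
  shows "x + y \<in> cubeV (Suc n)"
  unfolding cubeV_def
proof safe
  fix i
  have "- (2 ^ n) \<le> x $ i" "x $ i < 2 ^ n" "- (2 ^ n) \<le> y $ i" "y $ i < 2 ^ n"
    using assms by (auto simp: cubeV_def)
  then show "- (2 ^ Suc n) \<le> (x + y) $ i" "(x + y) $ i < 2 ^ Suc n"
    by simp_all
qed

lemma cubeV_mono: "m \<le> n \<Longrightarrow> cubeV m \<subseteq> cubeV n"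
proof
  fix x :: "int ^ 'd" assume mn: "m \<le> n" and x: "x \<in> cubeV m"
  have le: "(2::int) ^ m \<le> 2 ^ n" using mn by (simp add: power_increasing)
  show "x \<in> cubeV n"
    unfolding cubeV_def
  proof safe
    fix i
    have "- (2 ^ m) \<le> x $ i" "x $ i < 2 ^ m" using x by (auto simp: cubeV_def)
    then show "- (2 ^ n) \<le> x $ i" "x $ i < 2 ^ n" using le by linarith+
  qed
qed

lemma ex_cubeV: "\<exists>n. x \<in> cubeV n"
proof -
  \<comment> \<open>The l1 norm is a crude level that suffices, since
    \<open>s < 2 ^ s\<close>.\<close>
  define s where "s = (\<Sum>i\<in>UNIV. nat \<bar>x $ i\<bar>)"
  have "x \<in> cubeV s"
    unfolding cubeV_def
  proof safe
    fix i
    have "nat \<bar>x $ i\<bar> \<le> s" unfolding s_def by (rule member_le_sum) auto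
    moreover have "s < 2 ^ s" by simp
    ultimately have "int (nat \<bar>x $ i\<bar>) < int (2 ^ s)" by linarith
    then have "\<bar>x $ i\<bar> < 2 ^ s" by simp
    then show "- (2 ^ s) \<le> x $ i" "x $ i < 2 ^ s" by linarith+
  qed
  then show ?thesis ..
qed

lemma eventually_in_cubeV: "eventually (\<lambda>n. x \<in> cubeV n) sequentially"
proof -
  obtain m where "x \<in> cubeV m" using ex_cubeV by blast
  then show ?thesis
    using cubeV_mono by (auto simp: eventually_sequentially intro!: exI[of _ m])
qed

lemma abs_le_eucl_norm: "\<bar>real_of_int (x $ i)\<bar> \<le> eucl_norm x"
proof -
  have "(real_of_int (x $ i))\<^sup>2 \<le> (\<Sum>i\<in>UNIV. (real_of_int (x $ i))\<^sup>2)"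
    by (rule member_le_sum) auto
  then show ?thesis
    unfolding eucl_norm_def using real_le_rsqrt by force
qed

lemma eucl_norm_ge_of_notin_cubeV:
  assumes "x \<notin> cubeV n"
  shows "2 ^ n \<le> eucl_norm x"
proof -
  obtain i where "\<not> (- (2 ^ n) \<le> x $ i \<and> x $ i < 2 ^ n)"
    using assms by (auto simp: cubeV_def)
  then have "2 ^ n \<le> \<bar>x $ i\<bar>" by linarith
  then have "real_of_int (2 ^ n) \<le> real_of_int \<bar>x $ i\<bar>"
    by (rule of_int_le_iff[THEN iffD2])
  then show ?thesis
    using abs_le_eucl_norm[of x i] by simp
qed

lemma eucl_norm_ge_1:
  assumes "x \<noteq> 0"
  shows "1 \<le> eucl_norm x"
proof -
  obtain i where "x $ i \<noteq> 0" using assms by (auto simp: vec_eq_iff)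
  then have "1 \<le> \<bar>x $ i\<bar>" by linarith
  then have "1 \<le> \<bar>real_of_int (x $ i)\<bar>"
    by linarith
  then show ?thesis
    using abs_le_eucl_norm[of x i] by simp
qed

lemma eucl_norm_le_of_in_cubeV:
  fixes x :: "int ^ 'd"
  assumes "x \<in> cubeV n"
  shows "eucl_norm x \<le> sqrt (real CARD('d)) * 2 ^ n"
proof -
  have "(real_of_int (x $ i))\<^sup>2 \<le> (2 ^ n)\<^sup>2" for i
  proof -
    have "- (2 ^ n) \<le> x $ i" "x $ i < 2 ^ n" using assms by (auto simp: cubeV_def)
    then have "\<bar>x $ i\<bar> \<le> 2 ^ n" by linarith
    then have "real_of_int \<bar>x $ i\<bar> \<le> real_of_int (2 ^ n)"
      by (rule of_int_le_iff[THEN iffD2])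
    then show ?thesis by (simp add: abs_le_square_iff[symmetric])
  qed
  then have "(\<Sum>i\<in>(UNIV::'d set). (real_of_int (x $ i))\<^sup>2) \<le> real CARD('d) * (2 ^ n)\<^sup>2"
    using sum_mono[of "UNIV::'d set" "\<lambda>i. (real_of_int (x $ i))\<^sup>2" "\<lambda>_. (2 ^ n)\<^sup>2"] by simp
  then have "eucl_norm x \<le> sqrt (real CARD('d) * (2 ^ n)\<^sup>2)"
    unfolding eucl_norm_def by (rule real_sqrt_le_mono)
  then show ?thesis by (simp add: real_sqrt_mult)
qed

subsection \<open>Macroscopic Minkowski dimension\<close>

text \<open>The constant \<open>K\<close> adds only \<open>log 2 K / real n\<close> to the exponent,
  which tends to 0.\<close>

lemma upper_mink_dim_leI:
  assumes K: "1 \<le> K" and \<gamma>: "0 \<le> \<gamma>"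
    and ev: "eventually (\<lambda>n. real (card (A \<inter> cubeV n)) \<le> K * 2 powr (\<gamma> * real n)) sequentially"
  shows "upper_mink_dim A \<le> ereal \<gamma>"
proof -
  have "(\<lambda>n. \<gamma> + log 2 K / real n) \<longlonglongrightarrow> \<gamma> + 0"
    by (intro tendsto_add tendsto_const lim_const_over_n)
  then have lim: "limsup (\<lambda>n. ereal (\<gamma> + log 2 K / real n)) = ereal \<gamma>"
    by (intro lim_imp_Limsup) simp_all
  have "eventually (\<lambda>n. ereal (log 2 (real (card (A \<inter> cubeV n))) / real n)
      \<le> ereal (\<gamma> + log 2 K / real n)) sequentially"
    using ev eventually_gt_at_top[of 0]
  proof eventually_elim
    case (elim n)
    let ?c = "real (card (A \<inter> cubeV n))"
    \<comment> \<open>An empty intersection gives \<open>log 2 0 = 0\<close>, which is below the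
      bound because \<open>K\<close> is at least 1 and \<open>\<gamma>\<close> is
      nonnegative.\<close>
    have "log 2 ?c \<le> log 2 K + \<gamma> * real n"
    proof (cases "?c = 0")
      case True
      moreover have "0 \<le> log 2 K" using K by simp
      ultimately show ?thesis using \<gamma> by (simp add: log_def)
    next
      case False
      then have "0 < ?c" by linarith
      then have "log 2 ?c \<le> log 2 (K * 2 powr (\<gamma> * real n))"
        using elim by (intro log_mono) simp_all
      also have "\<dots> = log 2 K + \<gamma> * real n"
        using K by (simp add: log_mult)
      finally show ?thesis .
    qed
    then show ?case using elim by (simp add: field_simps)
  qed
  then have "upper_mink_dim A \<le> limsup (\<lambda>n. ereal (\<gamma> + log 2 K / real n))"
    unfolding upper_mink_dim_def by (rule Limsup_mono)
  then show ?thesis using lim by simp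
qed

lemma upper_mink_dim_geI:
  assumes "frequently (\<lambda>n. 2 powr (\<gamma> * real n) \<le> real (card (A \<inter> cubeV n))) sequentially"
  shows "ereal \<gamma> \<le> upper_mink_dim A"
proof (rule ccontr)
  assume "\<not> ?thesis"
  then have "eventually (\<lambda>n. ereal (log 2 (real (card (A \<inter> cubeV n))) / real n) < ereal \<gamma>) sequentially"
    unfolding upper_mink_dim_def by (intro Limsup_lessD) simp
  then have "eventually (\<lambda>n. \<not> 2 powr (\<gamma> * real n) \<le> real (card (A \<inter> cubeV n))) sequentially"
    using eventually_gt_at_top[of 0]
  proof eventually_elim
    case (elim n)
    show ?case
    proof
      assume le: "2 powr (\<gamma> * real n) \<le> real (card (A \<inter> cubeV n))"
      then have "log 2 (2 powr (\<gamma> * real n)) \<le> log 2 (real (card (A \<inter> cubeV n)))"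
        by (intro log_mono) auto
      then have "\<gamma> * real n \<le> log 2 (real (card (A \<inter> cubeV n)))" by simp
      then show False using elim by (simp add: field_simps)
    qed
  qed
  then show False using assms by (simp add: frequently_def)
qed

lemma eventually_card_le_of_upper_mink_dim_less:
  assumes "upper_mink_dim A < ereal \<gamma>"
  shows "eventually (\<lambda>n. real (card (A \<inter> cubeV n)) \<le> 2 powr (\<gamma> * real n)) sequentially"
proof (rule ccontr)
  assume "\<not> ?thesis"
  then have "frequently (\<lambda>n. 2 powr (\<gamma> * real n) \<le> real (card (A \<inter> cubeV n))) sequentially"
    unfolding frequently_def by (auto elim!: contrapos_nn eventually_mono)
  from upper_mink_dim_geI[OF this] assms show False by simp
qed

text \<open>A nonzero cardinality is at least 1, and an empty intersection contributes 0 because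
  \<open>log 2 0 = 0\<close>. So every term of the limsup is nonnegative, even for the empty
  set.\<close>

lemma upper_mink_dim_nonneg: "0 \<le> upper_mink_dim A"
proof -
  have "0 \<le> log 2 (real (card (A \<inter> cubeV n))) / real n" for n
  proof (cases "card (A \<inter> cubeV n) = 0")
    case False
    then have "1 \<le> real (card (A \<inter> cubeV n))" by linarith
    then show ?thesis by simp
  qed (simp add: log_def)
  then have "limsup (\<lambda>n::nat. 0::ereal) \<le> upper_mink_dim A"
    unfolding upper_mink_dim_def by (intro Limsup_mono always_eventually) simp
  then show ?thesis by (simp add: Limsup_const)
qed

lemma upper_mink_dim_le_CARD:
  fixes A :: "(int ^ 'd) set"
  shows "upper_mink_dim A \<le> ereal (real CARD('d))"
proof (rule upper_mink_dim_leI[of "2 ^ CARD('d)"])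
  have "real (card (A \<inter> cubeV n)) \<le> 2 ^ CARD('d) * 2 powr (real CARD('d) * real n)" for n
  proof -
    have "card (A \<inter> cubeV n) \<le> (2 * 2 ^ n) ^ CARD('d)"
      unfolding card_cubeV[symmetric, where ?'d='d] by (intro card_mono) auto
    then have "real (card (A \<inter> cubeV n)) \<le> real ((2 * 2 ^ n) ^ CARD('d))"
      by (rule of_nat_mono)
    also have "\<dots> = 2 ^ CARD('d) * 2 powr (real CARD('d) * real n)"
      using powr_realpow[of 2 "CARD('d) * n"]
      by (simp add: power_mult_distrib mult.commute flip: power_mult)
    finally show ?thesis .
  qed
  then show "eventually (\<lambda>n. real (card (A \<inter> cubeV n)) \<le> 2 ^ CARD('d) * 2 powr (real CARD('d) * real n)) sequentially"
    by simp
qed auto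

text \<open>Passing to the next level multiplies \<open>2 powr (\<gamma> * real n)\<close> by the
  constant \<open>2 powr \<gamma>\<close>, and constants do not affect the dimension. This makes the
  dimension insensitive to translations.\<close>

lemma upper_mink_dim_le_of_card_le_Suc:
  assumes K: "1 \<le> K"
    and ev: "eventually (\<lambda>n. real (card (A \<inter> cubeV n)) \<le> K * real (card (B \<inter> cubeV (Suc n)))) sequentially"
  shows "upper_mink_dim A \<le> upper_mink_dim B"
proof (rule ereal_le_real)
  fix z assume "upper_mink_dim B \<le> ereal z"
  show "upper_mink_dim A \<le> ereal z"
  proof (rule ereal_le_epsilon2)
    fix e :: real assume e: "0 < e"
    let ?\<gamma> = "z + e"
    have "0 \<le> ereal z" using upper_mink_dim_nonneg \<open>upper_mink_dim B \<le> ereal z\<close> by (rule order_trans)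
    then have \<gamma>: "0 \<le> ?\<gamma>" using e by simp
    have "upper_mink_dim B < ereal ?\<gamma>"
      using \<open>upper_mink_dim B \<le> ereal z\<close> by (rule le_less_trans) (use e in simp)
    then have "eventually (\<lambda>n. real (card (B \<inter> cubeV (Suc n))) \<le> 2 powr (?\<gamma> * real (Suc n))) sequentially"
      by (intro eventually_sequentially_Suc[THEN iffD2] eventually_card_le_of_upper_mink_dim_less)
    with ev have "eventually (\<lambda>n. real (card (A \<inter> cubeV n)) \<le> (K * 2 powr ?\<gamma>) * 2 powr (?\<gamma> * real n)) sequentially"
    proof eventually_elim
      case (elim n)
      have "real (card (A \<inter> cubeV n)) \<le> K * 2 powr (?\<gamma> * real (Suc n))"
        using elim K by (meson mult_left_mono order_trans zero_le_one)
      also have "\<dots> = (K * 2 powr ?\<gamma>) * 2 powr (?\<gamma> * real n)"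
        by (simp add: powr_add[symmetric] algebra_simps)
      finally show ?case .
    qed
    moreover have "1 \<le> K * 2 powr ?\<gamma>"
      using mult_mono[OF K ge_one_powr_ge_zero[OF _ \<gamma>, of 2]] K by simp
    ultimately show "upper_mink_dim A \<le> ereal z + ereal e"
      using upper_mink_dim_leI[OF _ \<gamma>] by simp
  qed
qed

section \<open>Measurability of the walk and of the dimension of its range\<close>

lemma measurable_walk:
  fixes \<eta> :: "nat \<Rightarrow> 'w \<Rightarrow> int ^ 'd"
  assumes "\<And>i. \<eta> i \<in> measurable N (count_space UNIV)"
  shows "walk \<eta> n \<in> measurable N (count_space UNIV)"
proof (induction n)
  case 0
  show ?case unfolding walk_def by simp
next
  case (Suc n)
  note [measurable] = Suc assms
  have "(\<lambda>\<omega>. walk \<eta> n \<omega> + \<eta> n \<omega>) \<in> measurable N (count_space UNIV)"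
    by measurable
  then show ?case unfolding walk_def by simp
qed

text \<open>Each count is a finite sum of indicators of hitting events. The measure \<open>N\<close>
  is arbitrary because the lemma is applied both to \<open>M\<close> and to the sigma-algebra
  generated by the steps from some time on.\<close>

lemma measurable_upper_mink_dim_range_walk:
  fixes \<eta> :: "nat \<Rightarrow> 'w \<Rightarrow> int ^ 'd"
  assumes "\<And>i. \<eta> i \<in> measurable N (count_space UNIV)"
  shows "(\<lambda>\<omega>. upper_mink_dim (range_walk \<eta> \<omega>)) \<in> borel_measurable N"
proof -
  note [measurable] = measurable_walk[OF assms]
  have "real (card (range_walk \<eta> \<omega> \<inter> cubeV n)) = (\<Sum>x\<in>cubeV n. if \<exists>k. walk \<eta> k \<omega> = x then 1 else 0)" for n \<omega>
  proof -
    have eq: "range_walk \<eta> \<omega> \<inter> cubeV n = {x\<in>cubeV n. \<exists>k. walk \<eta> k \<omega> = x}"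
      by (auto simp: range_walk_def)
    show ?thesis unfolding eq by (simp flip: sum.inter_filter)
  qed
  then show ?thesis
    unfolding upper_mink_dim_def by simp
qed

subsection \<open>First entrance and doubling of the Green mass\<close>

text \<open>A partial sum on the left runs over the triangle \<open>k + m < N\<close>, which lies in
  a square. It separates the time of first entrance from the time elapsed since.\<close>

lemma suminf_convolution_le:
  fixes Q :: "nat \<Rightarrow> nat \<Rightarrow> ennreal"
  shows "(\<Sum>n. \<Sum>k\<le>n. Q k (n - k)) \<le> (\<Sum>k. \<Sum>m. Q k m)"
proof (rule suminf_le_const[OF summableI])
  fix N
  have "(\<Sum>n<N. \<Sum>k\<le>n. Q k (n - k)) = (\<Sum>(k, m)\<in>{(k, m). k + m < N}. Q k m)"
    by (rule sum.triangle_reindex[symmetric])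
  also have "\<dots> \<le> (\<Sum>(k, m)\<in>{..<N} \<times> {..<N}. Q k m)"
    by (intro sum_mono2) auto
  also have "\<dots> = (\<Sum>k<N. \<Sum>m<N. Q k m)"
    by (simp add: sum.cartesian_product)
  also have "\<dots> \<le> (\<Sum>k<N. \<Sum>m. Q k m)"
    by (intro sum_mono sum_le_suminf) auto
  also have "\<dots> \<le> (\<Sum>k. \<Sum>m. Q k m)"
    by (intro sum_le_suminf) auto
  finally show "(\<Sum>n<N. \<Sum>k\<le>n. Q k (n - k)) \<le> (\<Sum>k. \<Sum>m. Q k m)" .
qed

text \<open>Off the event, \<open>f\<close> is below \<open>a / 2\<close>; on it, \<open>f\<close>
  is controlled by its square through the inequality of arithmetic and geometric means. Taking
  expectations leaves a lower bound on the probability.\<close>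

lemma (in prob_space) Paley_Zygmund_half:
  fixes f :: "'a \<Rightarrow> real"
  assumes int: "integrable M f" "integrable M (\<lambda>x. (f x)\<^sup>2)"
    and a: "0 < a" "a \<le> expectation f" and b: "0 < b" "expectation (\<lambda>x. (f x)\<^sup>2) \<le> b"
  shows "a\<^sup>2 / (4 * b) \<le> prob {x \<in> space M. a / 2 \<le> f x}"
proof -
  \<comment> \<open>With this choice the second-moment term \<open>t / 2 * b\<close> equals
    \<open>a / 4\<close>, so a quarter of \<open>a\<close> remains for the event.\<close>
  define t where "t = a / (2 * b)"
  have t: "0 < t" using a b by (simp add: t_def)
  define A where "A = {x \<in> space M. a / 2 \<le> f x}"
  have [measurable]: "f \<in> borel_measurable M" using int by auto
  have A [measurable]: "A \<in> sets M" unfolding A_def by measurable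
  have int_A: "integrable M (indicator A :: 'a \<Rightarrow> real)"
    by (intro integrable_real_indicator A) (simp add: emeasure_eq_measure)
  have am_gm: "y \<le> t / 2 * y\<^sup>2 + 1 / (2 * t)" for y
  proof -
    have "0 \<le> (t * y - 1)\<^sup>2" by simp
    then show ?thesis using t by (simp add: field_simps power2_eq_square)
  qed
  have pt: "f x \<le> a / 2 + t / 2 * (f x)\<^sup>2 + 1 / (2 * t) * indicator A x" if "x \<in> space M" for x
  proof (cases "a / 2 \<le> f x")
    case True
    then show ?thesis using am_gm[of "f x"] a that by (simp add: A_def)
  next
    case False
    moreover have "0 \<le> t / 2 * (f x)\<^sup>2" using t by simp
    ultimately show ?thesis by (simp add: A_def)
  qed
  have "a \<le> expectation f" by fact
  also have "\<dots> \<le> expectation (\<lambda>x. a / 2 + t / 2 * (f x)\<^sup>2 + 1 / (2 * t) * indicator A x)"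
    using int int_A by (intro integral_mono pt) auto
  also have "\<dots> = a / 2 + t / 2 * expectation (\<lambda>x. (f x)\<^sup>2) + 1 / (2 * t) * prob A"
    using int int_A A by (simp add: prob_space)
  also have "\<dots> \<le> a / 2 + t / 2 * b + 1 / (2 * t) * prob A"
    using b t by simp
  finally have "a \<le> a / 2 + t / 2 * b + 1 / (2 * t) * prob A" .
  then show ?thesis
    using a b unfolding t_def A_def[symmetric] by (simp add: field_simps power2_eq_square)
qed

section \<open>Markov property of the walk\<close>

lemma walk_add: "walk \<xi> (k + m) \<omega> = walk \<xi> k \<omega> + walk (\<lambda>i. \<xi> (k + i)) m \<omega>"
  by (induction m) (simp_all add: walk_def add.assoc)

text \<open>By injectivity, a finite subfamily indexed by \<open>K\<close> is the original subfamily
  indexed by the image of \<open>K\<close>, with the same product of probabilities. It is applied to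
  the time shift of the steps.\<close>

lemma (in prob_space) indep_vars_inj_reindex:
  assumes ind: "indep_vars M' X I" and f: "inj_on f J" "f ` J \<subseteq> I"
  shows "indep_vars (\<lambda>j. M' (f j)) (\<lambda>j. X (f j)) J"
  unfolding indep_vars_def2
proof (intro conjI ballI)
  fix j assume "j \<in> J" then show "random_variable (M' (f j)) (X (f j))"
    using ind f unfolding indep_vars_def2 by auto
next
  let ?F = "\<lambda>i. {X i -` A \<inter> space M |A. A \<in> sets (M' i)}"
  have I: "indep_sets ?F I" using ind unfolding indep_vars_def2 by auto
  show "indep_sets (\<lambda>j. ?F (f j)) J"
  proof (rule indep_setsI)
    fix j assume "j \<in> J" then show "?F (f j) \<subseteq> events"
      using I f unfolding indep_sets_def by blast
  next
    fix A K assume K: "K \<noteq> {}" "K \<subseteq> J" "finite K" and A: "\<forall>j\<in>K. A j \<in> ?F (f j)"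
    have inj: "inj_on f K" using f K by (meson inj_on_subset)
    \<comment> \<open>The chosen events are carried to the image of \<open>K\<close> along the
      inverse of \<open>f\<close>.\<close>
    let ?A = "\<lambda>i. A (the_inv_into K f i)"
    have inv: "?A (f j) = A j" if "j \<in> K" for j
      using the_inv_into_f_f[OF inj that] by simp
    have "prob (\<Inter>i\<in>f ` K. ?A i) = (\<Prod>i\<in>f ` K. prob (?A i))"
    proof (rule indep_setsD[OF I])
      show "\<forall>i\<in>f ` K. ?A i \<in> ?F i" using A inv by force
    qed (use K f in auto)
    then show "prob (\<Inter>j\<in>K. A j) = (\<Prod>j\<in>K. prob (A j))"
      using inv by (simp add: prod.reindex[OF inj] cong: INF_cong prod.cong)
  qed
qed

locale random_walk = prob_space M for M :: "'w measure" +
  fixes \<xi> :: "nat \<Rightarrow> 'w \<Rightarrow> int ^ 'd"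
  assumes measurable_step [measurable]: "\<And>i. \<xi> i \<in> measurable M (count_space UNIV)"
    and indep_steps: "indep_vars (\<lambda>_. count_space UNIV) \<xi> UNIV"
    and ident_steps: "\<And>i. distr M (count_space UNIV) (\<xi> i) = distr M (count_space UNIV) (\<xi> 0)"
begin

lemma measurable_walk_step [measurable]: "walk \<xi> n \<in> measurable M (count_space UNIV)"
  by (rule measurable_walk) measurable

text \<open>The shifted steps and the original ones have the same law on sequence space, the product
  of copies of the law of one step, and both events are preimages of one set of sequences.\<close>

lemma emeasure_walk_shift:
  "emeasure M {\<omega> \<in> space M. walk (\<lambda>i. \<xi> (k + i)) m \<omega> \<in> C}
    = emeasure M {\<omega> \<in> space M. walk \<xi> m \<omega> \<in> C}"
proof -
  let ?P = "PiM UNIV (\<lambda>_::nat. count_space (UNIV :: (int ^ 'd) set))"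
  let ?D = "distr M (count_space UNIV) (\<xi> 0)"
  let ?F = "{f \<in> space ?P. walk (\<lambda>i f. f i) m f \<in> C}"
  have [measurable]: "walk (\<lambda>i f. f i) m \<in> measurable ?P (count_space UNIV)"
    by (rule measurable_walk) measurable
  have F: "?F \<in> sets ?P" by measurable
  have "distr M ?P (\<lambda>\<omega>. \<lambda>i\<in>UNIV. \<xi> (k + i) \<omega>) = PiM UNIV (\<lambda>_. ?D)" for k
  proof -
    have "indep_vars (\<lambda>_. count_space UNIV) (\<lambda>i. \<xi> (k + i)) UNIV"
      using indep_vars_inj_reindex[OF indep_steps, of "\<lambda>i. k + i" UNIV] by simp
    then have "distr M ?P (\<lambda>\<omega>. \<lambda>i\<in>UNIV. \<xi> (k + i) \<omega>)
        = PiM UNIV (\<lambda>i. distr M (count_space UNIV) (\<xi> (k + i)))"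
      by (subst (asm) indep_vars_iff_distr_eq_PiM) auto
    also have "\<dots> = PiM UNIV (\<lambda>_. ?D)"
      by (intro PiM_cong refl ident_steps)
    finally show ?thesis .
  qed
  note law = this
  have "emeasure M {\<omega> \<in> space M. walk (\<lambda>i. \<xi> (k + i)) m \<omega> \<in> C}
      = emeasure (distr M ?P (\<lambda>\<omega>. \<lambda>i\<in>UNIV. \<xi> (k + i) \<omega>)) ?F" for k
    by (subst emeasure_distr[OF _ F])
       (auto intro!: arg_cong2[where f=emeasure] simp: walk_def space_PiM)
  from this[of k] this[of 0] show ?thesis
    unfolding law by simp
qed

text \<open>Disjoint blocks of steps are independent. A finite product of countable discrete spaces
  is discrete, so \<open>Q\<close> may be any predicate of the first \<open>k\<close> steps.\<close>

lemma emeasure_markov: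
  "emeasure M {\<omega> \<in> space M. Q (\<lambda>i\<in>{..<k}. \<xi> i \<omega>) \<and> walk (\<lambda>i. \<xi> (k + i)) m \<omega> \<in> C}
    = emeasure M {\<omega> \<in> space M. Q (\<lambda>i\<in>{..<k}. \<xi> i \<omega>)} * emeasure M {\<omega> \<in> space M. walk \<xi> m \<omega> \<in> C}"
proof -
  let ?c = "\<lambda>_::nat. count_space (UNIV :: (int ^ 'd) set)"
  let ?J = "{k..<k + m}"
  have PiM_eq: "PiM J ?c = count_space (PiE J (\<lambda>_. UNIV))" if "finite J" for J
    using that by (rule count_space_PiM_finite) simp
  let ?A = "{f \<in> PiE {..<k} (\<lambda>_. UNIV). Q f}"
  let ?B = "{f \<in> PiE ?J (\<lambda>_. UNIV). walk (\<lambda>i f. f (k + i)) m f \<in> C}"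
  have "indep_var (PiM {..<k} ?c) (\<lambda>\<omega>. \<lambda>i\<in>{..<k}. \<xi> i \<omega>) (PiM ?J ?c) (\<lambda>\<omega>. \<lambda>i\<in>?J. \<xi> i \<omega>)"
    by (rule indep_var_restrict[OF indep_steps]) auto
  from indep_varD[OF this, of ?A ?B]
  have "prob ((\<lambda>\<omega>. (\<lambda>i\<in>{..<k}. \<xi> i \<omega>, \<lambda>i\<in>?J. \<xi> i \<omega>)) -` (?A \<times> ?B) \<inter> space M)
    = prob ((\<lambda>\<omega>. \<lambda>i\<in>{..<k}. \<xi> i \<omega>) -` ?A \<inter> space M) * prob ((\<lambda>\<omega>. \<lambda>i\<in>?J. \<xi> i \<omega>) -` ?B \<inter> space M)"
    by (auto simp: PiM_eq)
  also have "(\<lambda>\<omega>. \<lambda>i\<in>{..<k}. \<xi> i \<omega>) -` ?A \<inter> space M = {\<omega> \<in> space M. Q (\<lambda>i\<in>{..<k}. \<xi> i \<omega>)}"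
    by auto
  also have B: "(\<lambda>\<omega>. \<lambda>i\<in>?J. \<xi> i \<omega>) -` ?B \<inter> space M = {\<omega> \<in> space M. walk (\<lambda>i. \<xi> (k + i)) m \<omega> \<in> C}"
    by (auto simp: walk_def)
  also have "(\<lambda>\<omega>. (\<lambda>i\<in>{..<k}. \<xi> i \<omega>, \<lambda>i\<in>?J. \<xi> i \<omega>)) -` (?A \<times> ?B) \<inter> space M
    = {\<omega> \<in> space M. Q (\<lambda>i\<in>{..<k}. \<xi> i \<omega>) \<and> walk (\<lambda>i. \<xi> (k + i)) m \<omega> \<in> C}"
    using B by auto
  finally show ?thesis
    unfolding emeasure_walk_shift[of k, symmetric]
    by (simp only: emeasure_eq_measure ennreal_mult measure_nonneg)
qed

text \<open>The set \<open>A\<close> serves two purposes: the target set gives the first entrance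
  decomposition, and \<open>A = {}\<close> gives the plain Markov property at time
  \<open>k\<close>.\<close>

lemma emeasure_walk_markov:
  "emeasure M {\<omega> \<in> space M. (walk \<xi> k \<omega> = b \<and> (\<forall>j<k. walk \<xi> j \<omega> \<notin> A)) \<and> walk \<xi> (k + m) \<omega> \<in> C}
    = emeasure M {\<omega> \<in> space M. walk \<xi> k \<omega> = b \<and> (\<forall>j<k. walk \<xi> j \<omega> \<notin> A)}
      * emeasure M {\<omega> \<in> space M. walk \<xi> m \<omega> + b \<in> C}"
proof -
  define Q where "Q f \<longleftrightarrow> (\<Sum>i<k. f i) = b \<and> (\<forall>j<k. (\<Sum>i<j. f i) \<notin> A)" for f
  have walk_restrict: "(\<Sum>i<j. restrict (\<lambda>i. \<xi> i \<omega>) {..<k} i) = walk \<xi> j \<omega>" if "j \<le> k" for j \<omega>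
    unfolding walk_def using that by (intro sum.cong) auto
  have Q: "Q (\<lambda>i\<in>{..<k}. \<xi> i \<omega>) \<longleftrightarrow> walk \<xi> k \<omega> = b \<and> (\<forall>j<k. walk \<xi> j \<omega> \<notin> A)" for \<omega>
    unfolding Q_def by (simp only: walk_restrict less_imp_le order_refl cong: conj_cong imp_cong)
  have "{\<omega> \<in> space M. (walk \<xi> k \<omega> = b \<and> (\<forall>j<k. walk \<xi> j \<omega> \<notin> A)) \<and> walk \<xi> (k + m) \<omega> \<in> C}
    = {\<omega> \<in> space M. (walk \<xi> k \<omega> = b \<and> (\<forall>j<k. walk \<xi> j \<omega> \<notin> A)) \<and>
        walk (\<lambda>i. \<xi> (k + i)) m \<omega> \<in> {x. x + b \<in> C}}"
    by (auto simp: walk_add add.commute)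
  then show ?thesis
    using emeasure_markov[of Q k m "{x. x + b \<in> C}"] unfolding Q by simp
qed

text \<open>The Green measure: the expected number of visits to \<open>A\<close>, counted with
  multiplicity.\<close>

definition green_set :: "(int ^ 'd) set \<Rightarrow> ennreal" where
  "green_set A = (\<Sum>n. emeasure M {\<omega> \<in> space M. walk \<xi> n \<omega> \<in> A})"

lemma green_set_singleton: "green_set {x} = green0 M \<xi> x"
  by (simp add: green_set_def green0_def)

lemma green_set_mono: "A \<subseteq> B \<Longrightarrow> green_set A \<le> green_set B"
  unfolding green_set_def by (intro suminf_le emeasure_mono summableI) auto

lemma green_set_eq_sum:
  assumes "finite A"
  shows "green_set A = (\<Sum>x\<in>A. green0 M \<xi> x)"
proof -
  have "emeasure M {\<omega> \<in> space M. walk \<xi> n \<omega> \<in> A} = (\<Sum>x\<in>A. emeasure M {\<omega> \<in> space M. walk \<xi> n \<omega> = x})" for n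
  proof -
    have "(\<Sum>x\<in>A. emeasure M {\<omega> \<in> space M. walk \<xi> n \<omega> = x}) = emeasure M (\<Union>x\<in>A. {\<omega> \<in> space M. walk \<xi> n \<omega> = x})"
      using assms by (intro sum_emeasure) (auto simp: disjoint_family_on_def)
    also have "(\<Union>x\<in>A. {\<omega> \<in> space M. walk \<xi> n \<omega> = x}) = {\<omega> \<in> space M. walk \<xi> n \<omega> \<in> A}"
      by auto
    finally show ?thesis by simp
  qed
  then show ?thesis
    unfolding green_set_def green0_def by (simp add: suminf_sum summableI)
qed

text \<open>Every visit to \<open>A\<close> comes at or after the first entrance. If that happens at
  time \<open>k\<close> in \<open>b\<close>, the walk restarts from \<open>b\<close> and makes
  \<open>green_set {x. x + b \<in> A}\<close> visits on average. The first entrance events are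
  disjoint and their probabilities add up to the probability of hitting \<open>A\<close>.\<close>

lemma green_set_first_entrance:
  assumes fin: "finite A" and c: "\<And>b. b \<in> A \<Longrightarrow> green_set {x. x + b \<in> A} \<le> c"
  shows "green_set A \<le> emeasure M {\<omega> \<in> space M. \<exists>n. walk \<xi> n \<omega> \<in> A} * c"
proof -
  let ?p = "\<lambda>m b. emeasure M {\<omega> \<in> space M. walk \<xi> m \<omega> + b \<in> A}"
  let ?E = "\<lambda>k b. {\<omega> \<in> space M. walk \<xi> k \<omega> = b \<and> (\<forall>j<k. walk \<xi> j \<omega> \<notin> A)}"
  let ?E' = "\<lambda>k b m. {\<omega> \<in> space M. (walk \<xi> k \<omega> = b \<and> (\<forall>j<k. walk \<xi> j \<omega> \<notin> A)) \<and> walk \<xi> (k + m) \<omega> \<in> A}"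
  let ?F = "\<lambda>k. {\<omega> \<in> space M. walk \<xi> k \<omega> \<in> A \<and> (\<forall>j<k. walk \<xi> j \<omega> \<notin> A)}"
  have first: "\<exists>k\<le>n. walk \<xi> k \<omega> \<in> A \<and> (\<forall>j<k. walk \<xi> j \<omega> \<notin> A)" if "walk \<xi> n \<omega> \<in> A" for n \<omega>
    using that by (intro exI[of _ "LEAST k. walk \<xi> k \<omega> \<in> A"])
      (auto intro: LeastI Least_le dest: not_less_Least)
  have "green_set A \<le> (\<Sum>n. \<Sum>k\<le>n. \<Sum>b\<in>A. emeasure M (?E k b) * ?p (n - k) b)"
    unfolding green_set_def
  proof (intro suminf_le summableI)
    fix n
    have "{\<omega> \<in> space M. walk \<xi> n \<omega> \<in> A} \<subseteq> (\<Union>k\<in>{..n}. \<Union>b\<in>A. ?E' k b (n - k))"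
      using first by fastforce
    then have "emeasure M {\<omega> \<in> space M. walk \<xi> n \<omega> \<in> A} \<le> emeasure M (\<Union>k\<in>{..n}. \<Union>b\<in>A. ?E' k b (n - k))"
      using fin by (intro emeasure_mono sets.finite_UN) auto
    also have "\<dots> \<le> (\<Sum>k\<le>n. emeasure M (\<Union>b\<in>A. ?E' k b (n - k)))"
      using fin by (intro emeasure_subadditive_finite image_subsetI sets.finite_UN) auto
    also have "\<dots> \<le> (\<Sum>k\<le>n. \<Sum>b\<in>A. emeasure M (?E' k b (n - k)))"
      using fin by (intro sum_mono emeasure_subadditive_finite image_subsetI) auto
    also have "\<dots> = (\<Sum>k\<le>n. \<Sum>b\<in>A. emeasure M (?E k b) * ?p (n - k) b)"
      by (simp only: emeasure_walk_markov)
    finally show "emeasure M {\<omega> \<in> space M. walk \<xi> n \<omega> \<in> A}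
      \<le> (\<Sum>k\<le>n. \<Sum>b\<in>A. emeasure M (?E k b) * ?p (n - k) b)" .
  qed
  also have "\<dots> \<le> (\<Sum>k. \<Sum>m. \<Sum>b\<in>A. emeasure M (?E k b) * ?p m b)"
    by (rule suminf_convolution_le)
  also have "\<dots> = (\<Sum>k. \<Sum>b\<in>A. emeasure M (?E k b) * green_set {x. x + b \<in> A})"
    by (simp add: suminf_sum summableI green_set_def)
  also have "\<dots> \<le> (\<Sum>k. \<Sum>b\<in>A. emeasure M (?E k b) * c)"
    by (intro suminf_le summableI sum_mono mult_left_mono c) auto
  also have "\<dots> = (\<Sum>k. emeasure M (?F k)) * c"
  proof -
    have "(\<Sum>b\<in>A. emeasure M (?E k b)) = emeasure M (?F k)" for k
    proof -
      have "(\<Sum>b\<in>A. emeasure M (?E k b)) = emeasure M (\<Union>b\<in>A. ?E k b)"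
        using fin by (intro sum_emeasure) (auto simp: disjoint_family_on_def)
      also have "(\<Union>b\<in>A. ?E k b) = ?F k" by auto
      finally show ?thesis .
    qed
    then show ?thesis by (simp flip: sum_distrib_right)
  qed
  also have "(\<Sum>k. emeasure M (?F k)) = emeasure M (\<Union>k. ?F k)"
  proof (intro suminf_emeasure)
    show "disjoint_family ?F"
      unfolding disjoint_family_on_def using nat_neq_iff by auto
  qed auto
  also have "(\<Union>k. ?F k) = {\<omega> \<in> space M. \<exists>n. walk \<xi> n \<omega> \<in> A}"
    using first by blast
  finally show ?thesis .
qed

text \<open>First entrance into a single point: the restart is at \<open>x\<close>, so the later
  visits are returns to the start, counted by the Green function at 0.\<close>

lemma green0_le_hit:
  "green0 M \<xi> x \<le> emeasure M {\<omega> \<in> space M. x \<in> range_walk \<xi> \<omega>} * green0 M \<xi> 0"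
proof -
  have *: "{y. y = 0} = {0 :: int ^ 'd}" by auto
  have "{\<omega> \<in> space M. x \<in> range_walk \<xi> \<omega>} = {\<omega> \<in> space M. \<exists>n. walk \<xi> n \<omega> \<in> {x}}"
    by (auto simp: range_walk_def)
  then show ?thesis
    using green_set_first_entrance[of "{x}" "green0 M \<xi> 0"]
    by (simp add: * green_set_singleton)
qed

text \<open>One of the two points is visited no later than the other. For each order, a union bound
  over the two times and the Markov property give a product of Green functions.\<close>

lemma emeasure_two_points:
  "emeasure M {\<omega> \<in> space M. x \<in> range_walk \<xi> \<omega> \<and> y \<in> range_walk \<xi> \<omega>}
    \<le> green0 M \<xi> x * green0 M \<xi> (y - x) + green0 M \<xi> y * green0 M \<xi> (x - y)"
proof -
  let ?E = "\<lambda>x y j m. {\<omega> \<in> space M. (walk \<xi> j \<omega> = x \<and> (\<forall>i<j. walk \<xi> i \<omega> \<notin> {})) \<and> walk \<xi> (j + m) \<omega> \<in> {y}}"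
  have bound: "emeasure M (\<Union>j. \<Union>m. ?E x y j m) \<le> green0 M \<xi> x * green0 M \<xi> (y - x)" for x y
  proof -
    have "emeasure M (\<Union>j. \<Union>m. ?E x y j m) \<le> (\<Sum>j. emeasure M (\<Union>m. ?E x y j m))"
      by (intro emeasure_subadditive_countably) auto
    also have "\<dots> \<le> (\<Sum>j. \<Sum>m. emeasure M (?E x y j m))"
      by (intro suminf_le summableI emeasure_subadditive_countably) auto
    also have "\<dots> = green0 M \<xi> x * green0 M \<xi> (y - x)"
      unfolding emeasure_walk_markov by (simp add: green0_def eq_diff_eq)
    finally show ?thesis .
  qed
  have "{\<omega> \<in> space M. x \<in> range_walk \<xi> \<omega> \<and> y \<in> range_walk \<xi> \<omega>}
    \<subseteq> (\<Union>j. \<Union>m. ?E x y j m) \<union> (\<Union>j. \<Union>m. ?E y x j m)"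
  proof
    fix \<omega> assume "\<omega> \<in> {\<omega> \<in> space M. x \<in> range_walk \<xi> \<omega> \<and> y \<in> range_walk \<xi> \<omega>}"
    then obtain j k where \<omega>: "\<omega> \<in> space M" and jk: "walk \<xi> j \<omega> = x" "walk \<xi> k \<omega> = y"
      by (auto simp: range_walk_def)
    show "\<omega> \<in> (\<Union>j. \<Union>m. ?E x y j m) \<union> (\<Union>j. \<Union>m. ?E y x j m)"
    proof (cases "j \<le> k")
      case True
      then have "\<omega> \<in> ?E x y j (k - j)" using \<omega> jk by simp
      then show ?thesis by blast
    next
      case False
      then have "\<omega> \<in> ?E y x k (j - k)" using \<omega> jk by simp
      then show ?thesis by blast
    qed
  qed
  then have "emeasure M {\<omega> \<in> space M. x \<in> range_walk \<xi> \<omega> \<and> y \<in> range_walk \<xi> \<omega>}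
      \<le> emeasure M ((\<Union>j. \<Union>m. ?E x y j m) \<union> (\<Union>j. \<Union>m. ?E y x j m))"
    by (intro emeasure_mono) auto
  also have "\<dots> \<le> emeasure M (\<Union>j. \<Union>m. ?E x y j m) + emeasure M (\<Union>j. \<Union>m. ?E y x j m)"
    by (intro emeasure_subadditive) auto
  also have "\<dots> \<le> green0 M \<xi> x * green0 M \<xi> (y - x) + green0 M \<xi> y * green0 M \<xi> (x - y)"
    by (intro add_mono bound)
  finally show ?thesis .
qed

text \<open>This is \<open>4 ^ CARD('d)\<close>: the cube of level \<open>n + 1\<close> has side
  \<open>4 * 2 ^ n\<close>, hence splits into four intervals of length \<open>2 ^ n\<close> in each
  coordinate.\<close>

definition doubling_const :: real where
  "doubling_const = real (card {k :: int ^ 'd. \<forall>i. k $ i \<in> {- 2..1}})"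

lemma doubling_const_pos: "0 < doubling_const"
  unfolding doubling_const_def by (subst finite_card_vec_entries) simp_all

text \<open>The cube of level \<open>n + 1\<close> splits into boxes of side \<open>2 ^ n\<close>, and differences of points of
  one box lie in the cube of level \<open>n\<close>.\<close>
lemma green_set_cubeV_doubling:
  "green_set (cubeV (Suc n)) \<le> ennreal doubling_const * green_set (cubeV n)"
proof -
  let ?K = "{k :: int ^ 'd. \<forall>i. k $ i \<in> {- 2..1}}"
  \<comment> \<open>Integer division rounds down, also for negative coordinates, so the indices run
    exactly from -2 to 1 and all boxes have the same half-open shape.\<close>
  define box where "box k = {x \<in> cubeV (Suc n). \<forall>i. x $ i div 2 ^ n = k $ i}" for k :: "int ^ 'd"
  have finK: "finite ?K" by (rule finite_card_vec_entries) simp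
  have fin_box: "finite (box k)" for k unfolding box_def by simp
  have cover: "cubeV (Suc n) = (\<Union>k\<in>?K. box k)"
  proof (intro antisym subsetI)
    fix x :: "int ^ 'd" assume x: "x \<in> cubeV (Suc n)"
    let ?k = "\<chi> i. x $ i div 2 ^ n"
    have "x $ i div 2 ^ n \<in> {- 2..1}" for i
    proof -
      have b: "- 2 * 2 ^ n \<le> x $ i" "x $ i < 2 * 2 ^ n" using x by (auto simp: cubeV_def)
      have "- 2 = - 2 * 2 ^ n div (2 ^ n :: int)"
        by (rule nonzero_mult_div_cancel_right[symmetric]) simp
      also have "\<dots> \<le> x $ i div 2 ^ n"
        using b(1) by (rule zdiv_mono1) simp
      finally have "- 2 \<le> x $ i div 2 ^ n" .
      moreover have "x $ i div 2 ^ n < 2"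
      proof (rule mult_right_less_imp_less)
        show "x $ i div 2 ^ n * 2 ^ n < 2 * 2 ^ n"
          using b(2) by (simp flip: minus_mod_eq_div_mult) (smt (verit) pos_mod_sign zero_less_power)
      qed simp
      ultimately show ?thesis by simp
    qed
    then have "?k \<in> ?K" "x \<in> box ?k" using x by (auto simp: box_def)
    then show "x \<in> (\<Union>k\<in>?K. box k)" by blast
  qed (auto simp: box_def)
  \<comment> \<open>Wherever the box lies, a walk entering it at \<open>b\<close> sees the box as
    displacements inside \<open>cubeV n\<close>, and the probability of entering is at most
    1.\<close>
  have box_le: "green_set (box k) \<le> green_set (cubeV n)" for k
  proof -
    have "green_set (box k)
      \<le> emeasure M {\<omega> \<in> space M. \<exists>n. walk \<xi> n \<omega> \<in> box k} * green_set (cubeV n)"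
    proof (rule green_set_first_entrance[OF fin_box])
      fix b assume b: "b \<in> box k"
      have "{x. x + b \<in> box k} \<subseteq> cubeV n"
      proof
        fix x assume "x \<in> {x. x + b \<in> box k}"
        then have xb: "x + b \<in> box k" by simp
        show "x \<in> cubeV n" unfolding cubeV_def
        proof (intro CollectI allI)
          fix i
          have "(x $ i + b $ i) div 2 ^ n = b $ i div 2 ^ n"
            using xb b by (simp add: box_def)
          moreover have "x $ i + b $ i = 2 ^ n * ((x $ i + b $ i) div 2 ^ n) + (x $ i + b $ i) mod 2 ^ n"
            "b $ i = 2 ^ n * (b $ i div 2 ^ n) + b $ i mod 2 ^ n" by simp_all
          moreover have "0 \<le> (x $ i + b $ i) mod 2 ^ n" "(x $ i + b $ i) mod 2 ^ n < 2 ^ n"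
            "0 \<le> b $ i mod 2 ^ n" "b $ i mod 2 ^ n < 2 ^ n" by simp_all
          ultimately show "- (2 ^ n) \<le> x $ i \<and> x $ i < 2 ^ n" by (smt (verit))
        qed
      qed
      then show "green_set {x. x + b \<in> box k} \<le> green_set (cubeV n)" by (rule green_set_mono)
    qed
    also have "\<dots> \<le> 1 * green_set (cubeV n)"
      by (intro mult_right_mono measure_le_1) auto
    finally show ?thesis by simp
  qed
  have "green_set (cubeV (Suc n)) = (\<Sum>x\<in>cubeV (Suc n). green0 M \<xi> x)"
    by (simp add: green_set_eq_sum)
  also have "\<dots> = (\<Sum>k\<in>?K. \<Sum>x\<in>box k. green0 M \<xi> x)"
    unfolding cover using finK fin_box by (intro sum.UNION_disjoint) (auto simp: box_def vec_eq_iff)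
  also have "\<dots> \<le> (\<Sum>k\<in>?K. green_set (cubeV n))"
    using box_le fin_box by (intro sum_mono) (simp add: green_set_eq_sum)
  also have "\<dots> = ennreal doubling_const * green_set (cubeV n)"
    by (simp add: doubling_const_def ennreal_of_nat_eq_real_of_nat)
  finally show ?thesis .
qed

end

subsection \<open>Moments of the number of visited points\<close>

locale transient_random_walk = random_walk M \<xi>
  for M :: "'w measure" and \<xi> :: "nat \<Rightarrow> 'w \<Rightarrow> int ^ 'd" +
  assumes transient: "\<And>x. green0 M \<xi> x < \<top>"
begin

definition green :: "int ^ 'd \<Rightarrow> real" where
  "green x = enn2real (green0 M \<xi> x)"

definition green_cube :: "nat \<Rightarrow> real" where
  "green_cube n = (\<Sum>x\<in>cubeV n. green x)"

lemma green_nonneg [simp]: "0 \<le> green x"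
  by (simp add: green_def)

lemma green0_eq: "green0 M \<xi> x = ennreal (green x)"
  using transient[of x] by (simp add: green_def)

lemma green_set_cubeV: "green_set (cubeV n) = ennreal (green_cube n)"
  by (simp add: green_set_eq_sum green_cube_def green0_eq)

lemma green_0_ge_1: "1 \<le> green 0"
proof -
  have "1 = (\<Sum>n<1. emeasure M {\<omega> \<in> space M. walk \<xi> n \<omega> = 0})"
    by (simp add: walk_def emeasure_space_1)
  also have "\<dots> \<le> green0 M \<xi> 0"
    unfolding green0_def by (intro sum_le_suminf) auto
  finally show ?thesis by (simp add: green0_eq)
qed

lemma green_cube_ge_1: "1 \<le> green_cube n"
proof -
  have "green 0 \<le> green_cube n"
    unfolding green_cube_def by (rule member_le_sum) auto
  with green_0_ge_1 show ?thesis by linarith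
qed

lemma green_cube_doubling: "green_cube (Suc n) \<le> doubling_const * green_cube n"
proof -
  have "ennreal (green_cube (Suc n)) \<le> ennreal (doubling_const * green_cube n)"
    using green_set_cubeV_doubling[of n] doubling_const_pos green_cube_ge_1[of n]
    by (simp add: green_set_cubeV ennreal_mult)
  then show ?thesis
    using doubling_const_pos green_cube_ge_1[of n] by (simp add: ennreal_le_iff)
qed

definition hit :: "int ^ 'd \<Rightarrow> 'w set" where
  "hit x = {\<omega> \<in> space M. x \<in> range_walk \<xi> \<omega>}"

lemma hit_sets [measurable]: "hit x \<in> sets M"
proof -
  have "hit x = {\<omega> \<in> space M. \<exists>n. walk \<xi> n \<omega> = x}"
    by (auto simp: hit_def range_walk_def)
  also have "\<dots> \<in> sets M" by measurable
  finally show ?thesis .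
qed

lemma prob_hit_ge: "green x / green 0 \<le> prob (hit x)"
proof -
  have "ennreal (green x) \<le> ennreal (prob (hit x) * green 0)"
    using green0_le_hit[of x] by (simp add: green0_eq emeasure_eq_measure ennreal_mult hit_def)
  then show ?thesis
    using green_0_ge_1 by (simp add: ennreal_le_iff field_simps)
qed

lemma emeasure_hit_le: "emeasure M (hit x) \<le> green0 M \<xi> x"
proof -
  have "hit x = (\<Union>n. {\<omega> \<in> space M. walk \<xi> n \<omega> = x})"
    by (auto simp: hit_def range_walk_def)
  then show ?thesis
    unfolding green0_def by (simp only:) (rule emeasure_subadditive_countably, auto)
qed

lemma prob_hit_two: "prob (hit x \<inter> hit y) \<le> green x * green (y - x) + green y * green (x - y)"
proof -
  have "hit x \<inter> hit y = {\<omega> \<in> space M. x \<in> range_walk \<xi> \<omega> \<and> y \<in> range_walk \<xi> \<omega>}"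
    by (auto simp: hit_def)
  then have "ennreal (prob (hit x \<inter> hit y)) \<le> ennreal (green x * green (y - x) + green y * green (x - y))"
    using emeasure_two_points[of x y] by (simp add: green0_eq emeasure_eq_measure ennreal_mult)
  then show ?thesis by (subst (asm) ennreal_le_iff) auto
qed

definition range_count :: "nat \<Rightarrow> 'w \<Rightarrow> real" where
  "range_count n \<omega> = real (card (range_walk \<xi> \<omega> \<inter> cubeV n))"

lemma range_count_eq_sum:
  assumes "\<omega> \<in> space M"
  shows "range_count n \<omega> = (\<Sum>x\<in>cubeV n. indicator (hit x) \<omega>)"
proof -
  have eq: "range_walk \<xi> \<omega> \<inter> cubeV n = {x\<in>cubeV n. \<omega> \<in> hit x}"
    using assms by (auto simp: hit_def)
  show ?thesis unfolding range_count_def eq by (simp add: indicator_def Int_def)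
qed

lemma measurable_range_count [measurable]: "range_count n \<in> borel_measurable M"
  by (subst measurable_cong[OF range_count_eq_sum]) auto

lemma expectation_range_count:
  "integrable M (range_count n)" "green_cube n / green 0 \<le> expectation (range_count n)"
proof -
  have int: "integrable M (\<lambda>\<omega>. \<Sum>x\<in>cubeV n. indicator (hit x) \<omega> :: real)"
    by (intro Bochner_Integration.integrable_sum integrable_real_indicator) (auto simp: emeasure_eq_measure)
  then show "integrable M (range_count n)"
    by (subst Bochner_Integration.integrable_cong[OF refl range_count_eq_sum])
  have "green_cube n / green 0 = (\<Sum>x\<in>cubeV n. green x / green 0)"
    by (simp add: green_cube_def sum_divide_distrib)
  also have "\<dots> \<le> (\<Sum>x\<in>cubeV n. prob (hit x))"
    by (intro sum_mono prob_hit_ge)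
  also have "\<dots> = expectation (\<lambda>\<omega>. \<Sum>x\<in>cubeV n. indicator (hit x) \<omega>)"
    by (subst Bochner_Integration.integral_sum) (auto simp: emeasure_eq_measure intro!: integrable_real_indicator)
  also have "\<dots> = expectation (range_count n)"
    by (intro Bochner_Integration.integral_cong) (auto simp: range_count_eq_sum)
  finally show "green_cube n / green 0 \<le> expectation (range_count n)" .
qed

text \<open>The square counts pairs of visited points. The two terms of the two-point bound
  contribute equally by symmetry, and for fixed \<open>x\<close> the differences
  \<open>y - x\<close> stay in the cube of level \<open>n + 1\<close>.\<close>

lemma second_moment_range_count:
  "integrable M (\<lambda>\<omega>. (range_count n \<omega>)\<^sup>2)"
  "expectation (\<lambda>\<omega>. (range_count n \<omega>)\<^sup>2) \<le> 2 * green_cube n * green_cube (Suc n)"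
proof -
  have sq: "(range_count n \<omega>)\<^sup>2 = (\<Sum>x\<in>cubeV n. \<Sum>y\<in>cubeV n. indicator (hit x \<inter> hit y) \<omega>)"
    if "\<omega> \<in> space M" for \<omega>
    unfolding range_count_eq_sum[OF that] power2_eq_square sum_product
    by (simp add: indicator_inter_arith)
  have int: "integrable M (\<lambda>\<omega>. \<Sum>x\<in>cubeV n. \<Sum>y\<in>cubeV n. indicator (hit x \<inter> hit y) \<omega> :: real)"
    by (intro Bochner_Integration.integrable_sum integrable_real_indicator) (auto simp: emeasure_eq_measure)
  then show "integrable M (\<lambda>\<omega>. (range_count n \<omega>)\<^sup>2)"
    by (subst Bochner_Integration.integrable_cong[OF refl sq])
  have shift: "(\<Sum>y\<in>cubeV n. green (y - x)) \<le> green_cube (Suc n)" if "x \<in> cubeV n" for x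
  proof -
    have "(\<Sum>y\<in>cubeV n. green (y - x)) = (\<Sum>z\<in>(\<lambda>y. y - x) ` cubeV n. green z)"
      by (subst sum.reindex) (auto simp: inj_on_def)
    also have "\<dots> \<le> green_cube (Suc n)"
      unfolding green_cube_def using that by (intro sum_mono2) (auto intro: cubeV_diff)
    finally show ?thesis .
  qed
  let ?S = "\<Sum>x\<in>cubeV n. \<Sum>y\<in>cubeV n. green x * green (y - x)"
  have "expectation (\<lambda>\<omega>. (range_count n \<omega>)\<^sup>2)
    = expectation (\<lambda>\<omega>. \<Sum>x\<in>cubeV n. \<Sum>y\<in>cubeV n. indicator (hit x \<inter> hit y) \<omega>)"
    by (intro Bochner_Integration.integral_cong) (auto simp: sq)
  also have "\<dots> = (\<Sum>x\<in>cubeV n. \<Sum>y\<in>cubeV n. prob (hit x \<inter> hit y))"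
    by (subst Bochner_Integration.integral_sum,
        auto intro!: Bochner_Integration.integrable_sum integrable_real_indicator simp: emeasure_eq_measure)
  also have "\<dots> \<le> (\<Sum>x\<in>cubeV n. \<Sum>y\<in>cubeV n. green x * green (y - x) + green y * green (x - y))"
    by (intro sum_mono prob_hit_two)
  also have "\<dots> = ?S + (\<Sum>x\<in>cubeV n. \<Sum>y\<in>cubeV n. green y * green (x - y))"
    by (simp add: sum.distrib)
  also have "(\<Sum>x\<in>cubeV n. \<Sum>y\<in>cubeV n. green y * green (x - y)) = ?S"
    by (rule sum.swap)
  also have "?S + ?S = 2 * (\<Sum>x\<in>cubeV n. green x * (\<Sum>y\<in>cubeV n. green (y - x)))"
    by (simp add: sum_distrib_left)
  also have "\<dots> \<le> 2 * (\<Sum>x\<in>cubeV n. green x * green_cube (Suc n))"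
    by (intro mult_left_mono sum_mono shift) auto
  also have "\<dots> = 2 * green_cube n * green_cube (Suc n)"
    by (simp add: green_cube_def sum_distrib_right)
  finally show "expectation (\<lambda>\<omega>. (range_count n \<omega>)\<^sup>2) \<le> 2 * green_cube n * green_cube (Suc n)" .
qed

text \<open>Doubling bounds the second moment by a constant times
  \<open>(green_cube n)\<^sup>2\<close>, so the Green mass cancels from the Paley-Zygmund ratio and
  the bound does not depend on \<open>n\<close>.\<close>

lemma prob_range_count_large:
  "1 / (8 * doubling_const * (green 0)\<^sup>2)
    \<le> prob {\<omega> \<in> space M. green_cube n / green 0 / 2 \<le> range_count n \<omega>}"
proof -
  let ?G = "green_cube n" and ?C = doubling_const
  have pos: "0 < ?G" "0 < green 0" "0 < ?C"
    using green_cube_ge_1[of n] green_0_ge_1 doubling_const_pos by simp_all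
  have "2 * ?G * green_cube (Suc n) \<le> 2 * ?G * (?C * ?G)"
    using pos by (intro mult_left_mono green_cube_doubling) auto
  then have "expectation (\<lambda>\<omega>. (range_count n \<omega>)\<^sup>2) \<le> 2 * ?G * (?C * ?G)"
    using second_moment_range_count(2)[of n] by linarith
  then have "(?G / green 0)\<^sup>2 / (4 * (2 * ?G * (?C * ?G)))
      \<le> prob {\<omega> \<in> space M. ?G / green 0 / 2 \<le> range_count n \<omega>}"
    using pos by (intro Paley_Zygmund_half expectation_range_count second_moment_range_count) auto
  also have "(?G / green 0)\<^sup>2 / (4 * (2 * ?G * (?C * ?G))) = 1 / (8 * ?C * (green 0)\<^sup>2)"
    using pos by (simp add: field_simps power2_eq_square)
  finally show ?thesis .
qed

text \<open>A point in the cube of level \<open>m + 1\<close> but not of level \<open>m\<close> has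
  norm at least \<open>2 ^ m\<close>. The series is thus dominated by the sum of
  \<open>2 powr (- \<gamma> * m) * green_cube (m + 1)\<close>, a geometric tail of ratio
  \<open>2 powr (\<gamma>' - \<gamma>)\<close>. The contrapositive turns divergence into growth of
  the Green mass.\<close>

lemma green_series_finite:
  assumes \<gamma>: "0 < \<gamma>" "\<gamma>' < \<gamma>"
    and ev: "eventually (\<lambda>n. green_cube n < 2 powr (\<gamma>' * real n)) sequentially"
  shows "(\<integral>\<^sup>+ x. green0 M \<xi> x / ennreal (eucl_norm x powr \<gamma>) \<partial>count_space (UNIV - {0})) < \<top>"
proof -
  let ?r = "\<lambda>n. 2 powr (- \<gamma> * real n)"
  let ?N = "count_space (UNIV - {0 :: int ^ 'd})"
  \<comment> \<open>The smallest cube is treated apart. Each dyadic shell is enlarged to the full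
    cube containing it; the overcounting is harmless because only the mass of cubes is
    controlled.\<close>
  have pt: "green0 M \<xi> x / ennreal (eucl_norm x powr \<gamma>)
      \<le> green0 M \<xi> x * indicator (cubeV 0) x + (\<Sum>n. ennreal (?r n) * (green0 M \<xi> x * indicator (cubeV (Suc n)) x))"
    if x: "x \<noteq> 0" for x
  proof (cases "x \<in> cubeV 0")
    case True
    have "1 \<le> eucl_norm x powr \<gamma>" using eucl_norm_ge_1[OF x] \<gamma> by (simp add: ge_one_powr_ge_zero)
    then have "green x / eucl_norm x powr \<gamma> \<le> green x / 1"
      by (intro divide_left_mono) auto
    then have "green0 M \<xi> x / ennreal (eucl_norm x powr \<gamma>) \<le> green0 M \<xi> x"
      using \<open>1 \<le> eucl_norm x powr \<gamma>\<close> by (subst green0_eq, subst divide_ennreal) (auto simp: green0_eq ennreal_le_iff)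
    then show ?thesis
      using True by (simp add: add_increasing2)
  next
    case False
    obtain n where n: "x \<in> cubeV n" "\<And>i. i < n \<Longrightarrow> x \<notin> cubeV i"
      using ex_cubeV[of x] exists_least_iff[of "\<lambda>n. x \<in> cubeV n"] by blast
    moreover have "n \<noteq> 0" using n False by metis
    ultimately obtain m where m: "x \<notin> cubeV m" "x \<in> cubeV (Suc m)"
      by (metis lessI not0_implies_Suc)
    have "(2 ^ m) powr \<gamma> \<le> eucl_norm x powr \<gamma>"
      using eucl_norm_ge_of_notin_cubeV[OF m(1)] \<gamma> by (intro powr_mono2) auto
    also have "(2 ^ m) powr \<gamma> = inverse (?r m)"
      by (simp add: powr_realpow[symmetric] powr_powr powr_minus mult.commute)
    finally have "inverse (eucl_norm x powr \<gamma>) \<le> inverse (inverse (?r m))"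
      by (rule le_imp_inverse_le) simp
    then have "inverse (eucl_norm x powr \<gamma>) * green x \<le> ?r m * green x"
      unfolding inverse_inverse_eq by (rule mult_right_mono) simp
    then have "green x / eucl_norm x powr \<gamma> \<le> ?r m * green x"
      by (simp only: divide_inverse mult.commute[of "green x"])
    moreover have "0 < eucl_norm x powr \<gamma>" using eucl_norm_ge_1[OF x] by simp
    ultimately have "green0 M \<xi> x / ennreal (eucl_norm x powr \<gamma>) \<le> ennreal (?r m) * (green0 M \<xi> x * indicator (cubeV (Suc m)) x)"
      using m by (simp add: green0_eq divide_ennreal ennreal_le_iff flip: ennreal_mult)
    also have "\<dots> \<le> (\<Sum>n. ennreal (?r n) * (green0 M \<xi> x * indicator (cubeV (Suc n)) x))"
      using sum_le_suminf[of "\<lambda>n. ennreal (?r n) * (green0 M \<xi> x * indicator (cubeV (Suc n)) x)" "{m}"] by simp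
    finally show ?thesis by (simp add: add_increasing)
  qed
  have cube: "(\<integral>\<^sup>+ x. green0 M \<xi> x * indicator (cubeV n) x \<partial>?N) \<le> ennreal (green_cube n)" for n
  proof -
    have "(\<integral>\<^sup>+ x. green0 M \<xi> x * indicator (cubeV n) x \<partial>?N)
      \<le> (\<integral>\<^sup>+ x. green0 M \<xi> x * indicator (cubeV n) x \<partial>count_space UNIV)"
      by (subst nn_integral_count_space_indicator) (auto intro!: nn_integral_mono simp: indicator_def)
    also have "\<dots> = (\<Sum>x\<in>cubeV n. green0 M \<xi> x * indicator (cubeV n) x)"
      by (intro nn_integral_count_space') auto
    also have "\<dots> = ennreal (green_cube n)"
      by (simp add: green0_eq green_cube_def indicator_def)
    finally show ?thesis .
  qed
  have "(\<integral>\<^sup>+ x. green0 M \<xi> x / ennreal (eucl_norm x powr \<gamma>) \<partial>?N)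
    \<le> (\<integral>\<^sup>+ x. green0 M \<xi> x * indicator (cubeV 0) x
        + (\<Sum>n. ennreal (?r n) * (green0 M \<xi> x * indicator (cubeV (Suc n)) x)) \<partial>?N)"
    by (intro nn_integral_mono pt) auto
  also have "\<dots> = (\<integral>\<^sup>+ x. green0 M \<xi> x * indicator (cubeV 0) x \<partial>?N)
      + (\<Sum>n. ennreal (?r n) * (\<integral>\<^sup>+ x. green0 M \<xi> x * indicator (cubeV (Suc n)) x \<partial>?N))"
    by (simp add: nn_integral_add nn_integral_suminf nn_integral_cmult)
  also have "\<dots> \<le> ennreal (green_cube 0) + (\<Sum>n. ennreal (?r n * green_cube (Suc n)))"
    using green_cube_ge_1 order_trans[OF zero_le_one green_cube_ge_1]
    by (intro add_mono suminf_le summableI cube) (auto simp: ennreal_mult intro!: mult_left_mono cube)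
  also have "\<dots> < \<top>"
  proof -
    have "summable (\<lambda>n. ?r n * green_cube (Suc n))"
    proof (rule summable_comparison_test_ev)
      have "eventually (\<lambda>n. green_cube (Suc n) < 2 powr (\<gamma>' * real (Suc n))) sequentially"
        using ev by (rule eventually_sequentially_Suc[THEN iffD2])
      then show "eventually (\<lambda>n. norm (?r n * green_cube (Suc n)) \<le> 2 powr \<gamma>' * (2 powr (\<gamma>' - \<gamma>)) ^ n) sequentially"
      proof eventually_elim
        case (elim n)
        have "norm (?r n * green_cube (Suc n)) = ?r n * green_cube (Suc n)"
          using green_cube_ge_1[of "Suc n"] by simp
        also have "\<dots> \<le> ?r n * 2 powr (\<gamma>' * real (Suc n))"
          using elim by (intro mult_left_mono) auto
        also have "\<dots> = 2 powr \<gamma>' * 2 powr ((\<gamma>' - \<gamma>) * real n)"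
          by (simp add: powr_add[symmetric] algebra_simps)
        also have "2 powr ((\<gamma>' - \<gamma>) * real n) = (2 powr (\<gamma>' - \<gamma>)) ^ n"
          by (simp add: powr_powr flip: powr_realpow)
        finally show ?case .
      qed
      have "2 powr (\<gamma>' - \<gamma>) < (1::real)" using \<gamma> by (simp add: powr_less_one)
      then show "summable (\<lambda>n. 2 powr \<gamma>' * (2 powr (\<gamma>' - \<gamma>)) ^ n)"
        by (intro summable_mult summable_geometric) simp
    qed
    then have "(\<Sum>n. ennreal (?r n * green_cube (Suc n))) \<noteq> \<top>"
      using order_trans[OF zero_le_one green_cube_ge_1] by (intro ennreal_suminf_neq_top) auto
    then show ?thesis by (simp add: less_top)
  qed
  finally show ?thesis .
qed

end

subsection \<open>The dimension of the range\<close>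

text \<open>Dropping the first \<open>k\<close> steps translates the rest of the range by
  \<open>walk \<xi> k \<omega>\<close> and loses at most \<open>k\<close> points. For large
  \<open>n\<close> the translation costs one level.\<close>

lemma upper_mink_dim_range_walk_shift:
  "upper_mink_dim (range_walk (\<lambda>i. \<xi> (k + i)) \<omega>) = upper_mink_dim (range_walk \<xi> \<omega>)"
proof (rule antisym)
  let ?a = "walk \<xi> k \<omega>" and ?R = "range_walk \<xi> \<omega>" and ?R' = "range_walk (\<lambda>i. \<xi> (k + i)) \<omega>"
  have ev: "eventually (\<lambda>n. ?a \<in> cubeV n) sequentially" by (rule eventually_in_cubeV)
  show "upper_mink_dim ?R' \<le> upper_mink_dim ?R"
  proof (rule upper_mink_dim_le_of_card_le_Suc[of 1])
    show "eventually (\<lambda>n. real (card (?R' \<inter> cubeV n)) \<le> 1 * real (card (?R \<inter> cubeV (Suc n)))) sequentially"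
      using ev
    proof eventually_elim
      case (elim n)
      have "(\<lambda>x. ?a + x) ` (?R' \<inter> cubeV n) \<subseteq> ?R \<inter> cubeV (Suc n)"
      proof (intro image_subsetI IntI)
        fix x assume x: "x \<in> ?R' \<inter> cubeV n"
        then obtain j where "x = walk (\<lambda>i. \<xi> (k + i)) j \<omega>" by (auto simp: range_walk_def)
        then have "?a + x = walk \<xi> (k + j) \<omega>" by (simp add: walk_add)
        then show "?a + x \<in> ?R" by (auto simp: range_walk_def)
        show "?a + x \<in> cubeV (Suc n)" using x elim by (intro cubeV_add) auto
      qed
      then have "card ((\<lambda>x. ?a + x) ` (?R' \<inter> cubeV n)) \<le> card (?R \<inter> cubeV (Suc n))"
        by (intro card_mono) auto
      then show ?case by (simp add: card_image)
    qed
  qed simp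
  show "upper_mink_dim ?R \<le> upper_mink_dim ?R'"
  proof (rule upper_mink_dim_le_of_card_le_Suc[of "real (k + 1)"])
    show "eventually (\<lambda>n. real (card (?R \<inter> cubeV n)) \<le> real (k + 1) * real (card (?R' \<inter> cubeV (Suc n)))) sequentially"
      using ev
    proof eventually_elim
      case (elim n)
      let ?F = "(\<lambda>j. walk \<xi> j \<omega>) ` {..<k}" and ?T = "?R' \<inter> cubeV (Suc n)"
      have "?R \<inter> cubeV n \<subseteq> ?F \<union> (\<lambda>x. ?a + x) ` ?T"
      proof
        fix x assume x: "x \<in> ?R \<inter> cubeV n"
        then obtain j where j: "x = walk \<xi> j \<omega>" by (auto simp: range_walk_def)
        show "x \<in> ?F \<union> (\<lambda>x. ?a + x) ` ?T"
        proof (cases "j < k")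
          case False
          then have "x - ?a = walk (\<lambda>i. \<xi> (k + i)) (j - k) \<omega>"
            using walk_add[of \<xi> k "j - k" \<omega>] j by simp
          then have "x - ?a \<in> ?R'" by (auto simp: range_walk_def)
          moreover have "x - ?a \<in> cubeV (Suc n)" using x elim by (intro cubeV_diff) auto
          ultimately have "x - ?a \<in> ?T" by simp
          then show ?thesis by (intro UnI2 image_eqI[of _ _ "x - ?a"]) auto
        qed (use j in auto)
      qed
      then have "card (?R \<inter> cubeV n) \<le> card (?F \<union> (\<lambda>x. ?a + x) ` ?T)"
        by (intro card_mono) auto
      also have "\<dots> \<le> card ?F + card ((\<lambda>x. ?a + x) ` ?T)"
        by (rule card_Un_le)
      also have "\<dots> \<le> k + card ?T"
        using card_image_le[of "{..<k}" "\<lambda>j. walk \<xi> j \<omega>"] by (simp add: card_image)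
      \<comment> \<open>The shifted walk starts at 0, so \<open>?T\<close> is nonempty and the
        additive \<open>k\<close> can be absorbed into a factor.\<close>
      also have "\<dots> \<le> (k + 1) * card ?T"
      proof -
        have "0 \<in> ?T" by (auto simp: range_walk_def walk_def intro!: exI[of _ 0])
        then have "1 \<le> card ?T" by (metis One_nat_def Suc_leI card_gt_0_iff empty_iff finite_Int finite_cubeV)
        then have "k * 1 \<le> k * card ?T" by (rule mult_le_mono2)
        then show ?thesis by simp
      qed
      finally show ?case by (simp only: of_nat_le_iff flip: of_nat_mult)
    qed
  qed simp
qed

section \<open>Zero-one law for the dimension\<close>

context random_walk
begin

text \<open>The dimension ignores finitely many points and translations, so it is a function of the steps
  from any time on, and Kolmogorov's zero-one law applies.\<close>
lemma dim_zero_one: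
  "prob {\<omega> \<in> space M. \<gamma> \<le> upper_mink_dim (range_walk \<xi> \<omega>)} = 0 \<or>
   prob {\<omega> \<in> space M. \<gamma> \<le> upper_mink_dim (range_walk \<xi> \<omega>)} = 1"
proof -
  let ?X = "{\<omega> \<in> space M. \<gamma> \<le> upper_mink_dim (range_walk \<xi> \<omega>)}"
  let ?A = "\<lambda>i. {\<xi> i -` A \<inter> space M |A. A \<in> sets (count_space UNIV)}"
  have "?X \<in> tail_events ?A"
    unfolding tail_events_def
  proof
    fix k
    let ?S = "\<Union> (?A ` {k..})"
    \<comment> \<open>The sigma-algebra of the steps from time \<open>k\<close> on. The dimension of
      the shifted range is measurable for it and equals the dimension of the range.\<close>
    let ?N = "sigma (space M) ?S"
    have S: "?S \<subseteq> Pow (space M)" by auto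
    have "\<xi> (k + i) \<in> measurable ?N (count_space UNIV)" for i
    proof (rule measurableI)
      fix B :: "(int ^ 'd) set"
      have "\<xi> (k + i) -` B \<inter> space M \<in> ?S" by (intro UN_I[of "k + i"]) auto
      then show "\<xi> (k + i) -` B \<inter> space ?N \<in> sets ?N"
        using S by (simp add: sets_measure_of space_measure_of sigma_sets.Basic)
    qed simp
    then have [measurable]: "(\<lambda>\<omega>. upper_mink_dim (range_walk (\<lambda>i. \<xi> (k + i)) \<omega>)) \<in> borel_measurable ?N"
      by (rule measurable_upper_mink_dim_range_walk)
    have "{\<omega> \<in> space ?N. \<gamma> \<le> upper_mink_dim (range_walk (\<lambda>i. \<xi> (k + i)) \<omega>)} \<in> sets ?N"
      by measurable
    then show "?X \<in> sigma_sets (space M) ?S"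
      unfolding upper_mink_dim_range_walk_shift using S by (simp add: sets_measure_of space_measure_of)
  qed
  moreover have "sigma_algebra (space M) (?A i)" for i
  proof -
    have "?A i = sets (vimage_algebra (space M) (\<xi> i) (count_space UNIV))"
      by (rule sets_vimage_algebra2[symmetric]) simp
    then show ?thesis
      using sets.sigma_algebra_axioms[of "vimage_algebra (space M) (\<xi> i) (count_space UNIV)"]
      by (simp only: space_vimage_algebra)
  qed
  moreover have "indep_sets ?A UNIV"
    using indep_steps unfolding indep_vars_def2 by auto
  ultimately show ?thesis by (intro kolmogorov_0_1_law)
qed

lemma measurable_dim [measurable]:
  "(\<lambda>\<omega>. upper_mink_dim (range_walk \<xi> \<omega>)) \<in> borel_measurable M"
  by (rule measurable_upper_mink_dim_range_walk) measurable

end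

section \<open>Almost sure bounds on the dimension\<close>

context transient_random_walk
begin

text \<open>Events of probability at least \<open>c\<close> occur infinitely often with probability
  at least \<open>c\<close>, and the zero-one law raises this to 1.\<close>

lemma AE_dim_ge:
  assumes \<gamma>: "\<gamma>' < \<gamma>"
    and freq: "frequently (\<lambda>n. 2 powr (\<gamma> * real n) \<le> green_cube n) sequentially"
  shows "AE \<omega> in M. ereal \<gamma>' \<le> upper_mink_dim (range_walk \<xi> \<omega>)"
proof -
  define c where "c = 1 / (8 * doubling_const * (green 0)\<^sup>2)"
  have c: "0 < c" using doubling_const_pos green_0_ge_1 by (simp add: c_def)
  define E where "E n = {\<omega> \<in> space M. green_cube n / green 0 / 2 \<le> range_count n \<omega>}" for n
  have E_sets [measurable]: "E n \<in> sets M" for n unfolding E_def by measurable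
  have E_prob: "c \<le> prob (E n)" for n
    unfolding c_def E_def by (rule prob_range_count_large)
  \<comment> \<open>Infinitely many levels where the Green mass is large and the gap between
    \<open>\<gamma>'\<close> and \<open>\<gamma>\<close> already absorbs the factor
    \<open>2 * green 0\<close>.\<close>
  define J where "J = {n. 2 powr (\<gamma> * real n) \<le> green_cube n \<and> 2 * green 0 \<le> 2 powr ((\<gamma> - \<gamma>') * real n)}"
  have "filterlim (\<lambda>n::nat. 2 powr ((\<gamma> - \<gamma>') * real n)) at_top sequentially"
    using \<gamma> by real_asymp
  then have "eventually (\<lambda>n. 2 * green 0 \<le> 2 powr ((\<gamma> - \<gamma>') * real n)) sequentially"
    by (simp add: filterlim_at_top)
  with freq have "frequently (\<lambda>n. n \<in> J) sequentially"
    unfolding J_def by (simp add: frequently_eventually_frequently)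
  then have J: "\<exists>n\<ge>m. n \<in> J" for m
    by (simp add: frequently_sequentially)
  define U where "U m = (\<Union>n\<in>{m..} \<inter> J. E n)" for m
  have U_sets [measurable]: "U m \<in> sets M" for m unfolding U_def by measurable
  have "c \<le> prob (U m)" for m
  proof -
    obtain n where n: "n \<ge> m" "n \<in> J" using J by blast
    have "prob (E n) \<le> prob (U m)"
      using n by (intro finite_measure_mono) (auto simp: U_def)
    then show ?thesis using E_prob[of n] by linarith
  qed
  moreover have "(\<lambda>m. prob (U m)) \<longlonglongrightarrow> prob (\<Inter>m. U m)"
  proof (rule finite_Lim_measure_decseq)
    show "decseq U" unfolding decseq_def U_def by (intro allI impI UN_mono) auto
  qed auto
  ultimately have "c \<le> prob (\<Inter>m. U m)"
    by (intro LIMSEQ_le_const) auto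
  also have "\<dots> \<le> prob {\<omega> \<in> space M. ereal \<gamma>' \<le> upper_mink_dim (range_walk \<xi> \<omega>)}"
  proof (intro finite_measure_mono subsetI CollectI conjI)
    fix \<omega> assume \<omega>: "\<omega> \<in> (\<Inter>m. U m)"
    then show "\<omega> \<in> space M" by (auto simp: U_def E_def)
    show "ereal \<gamma>' \<le> upper_mink_dim (range_walk \<xi> \<omega>)"
    proof (rule upper_mink_dim_geI, unfold frequently_sequentially, intro allI)
      fix m
      obtain n where n: "n \<ge> m" "n \<in> J" "\<omega> \<in> E n" using \<omega> by (auto simp: U_def)
      have "2 powr (\<gamma>' * real n) * (2 * green 0) \<le> 2 powr (\<gamma>' * real n) * 2 powr ((\<gamma> - \<gamma>') * real n)"
        using n by (intro mult_left_mono) (auto simp: J_def)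
      also have "\<dots> = 2 powr (\<gamma> * real n)"
        by (simp add: powr_add[symmetric] algebra_simps)
      also have "\<dots> \<le> green_cube n" using n by (simp add: J_def)
      finally have "2 powr (\<gamma>' * real n) \<le> green_cube n / green 0 / 2"
        using green_0_ge_1 by (simp add: field_simps)
      also have "\<dots> \<le> range_count n \<omega>" using n by (simp add: E_def)
      finally show "\<exists>n\<ge>m. 2 powr (\<gamma>' * real n) \<le> real (card (range_walk \<xi> \<omega> \<inter> cubeV n))"
        using n unfolding range_count_def by blast
    qed
  qed measurable
  finally have "prob {\<omega> \<in> space M. ereal \<gamma>' \<le> upper_mink_dim (range_walk \<xi> \<omega>)} = 1"
    using c dim_zero_one[of "ereal \<gamma>'"] by linarith
  then show ?thesis
    by (subst (asm) prob_Collect_eq_1) auto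
qed

text \<open>The sum \<open>W\<close> of \<open>eucl_norm x powr (- \<gamma>)\<close> over visited
  nonzero points has finite mean, as hitting probabilities are at most the Green function. Where
  \<open>W\<close> is finite, each visited nonzero point of \<open>cubeV n\<close> contributes at
  least a constant times \<open>2 powr (- \<gamma> * n)\<close>, which bounds their number.\<close>

lemma AE_dim_le:
  assumes \<gamma>: "0 < \<gamma>"
    and fin: "(\<integral>\<^sup>+ x. green0 M \<xi> x / ennreal (eucl_norm x powr \<gamma>) \<partial>count_space (UNIV - {0})) < \<top>"
  shows "AE \<omega> in M. upper_mink_dim (range_walk \<xi> \<omega>) \<le> ereal \<gamma>"
proof -
  let ?N = "count_space (UNIV - {0 :: int ^ 'd})"
  let ?h = "\<lambda>x \<omega>. indicator (hit x) \<omega> / ennreal (eucl_norm x powr \<gamma>)"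
  define W where "W \<omega> = (\<integral>\<^sup>+ x. ?h x \<omega> \<partial>?N)" for \<omega>
  have W_meas: "W \<in> borel_measurable M"
  proof -
    interpret N: sigma_finite_measure ?N by (rule sigma_finite_measure_count_space_countable) simp
    have "(\<lambda>(\<omega>, x). ?h x \<omega>) \<in> borel_measurable (M \<Otimes>\<^sub>M ?N)"
      by (subst measurable_pair_swap_iff) (intro measurable_pair_measure_countable1, auto)
    then show ?thesis unfolding W_def by (rule N.borel_measurable_nn_integral)
  qed
  have "(\<integral>\<^sup>+ \<omega>. W \<omega> \<partial>M) = (\<integral>\<^sup>+ x. \<integral>\<^sup>+ \<omega>. ?h x \<omega> \<partial>M \<partial>?N)"
    unfolding W_def by (rule nn_integral_count_space_nn_integral) auto
  also have "\<dots> = (\<integral>\<^sup>+ x. emeasure M (hit x) / ennreal (eucl_norm x powr \<gamma>) \<partial>?N)"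
    by (simp add: nn_integral_divide)
  also have "\<dots> \<le> (\<integral>\<^sup>+ x. green0 M \<xi> x / ennreal (eucl_norm x powr \<gamma>) \<partial>?N)"
    by (intro nn_integral_mono divide_right_mono_ennreal emeasure_hit_le)
  also note fin
  finally have "AE \<omega> in M. W \<omega> \<noteq> \<infinity>"
    using W_meas by (intro nn_integral_PInf_AE) auto
  then show ?thesis
    using AE_space
  proof eventually_elim
    case (elim \<omega>)
    define w where "w = enn2real (W \<omega>)"
    have w: "W \<omega> = ennreal w" "0 \<le> w" using elim by (auto simp: w_def less_top)
    let ?s = "sqrt (real CARD('d)) powr \<gamma>"
    \<comment> \<open>The summand 1 accounts for the origin, which \<open>W\<close> leaves out;
      \<open>?s\<close> comes from comparing the Euclidean norm with the side of the cube.\<close>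
    have "real (card (range_walk \<xi> \<omega> \<inter> cubeV n)) \<le> (1 + w * ?s) * 2 powr (\<gamma> * real n)" for n
    proof -
      let ?F = "range_walk \<xi> \<omega> \<inter> cubeV n - {0}"
      let ?D = "(sqrt (real CARD('d)) * 2 ^ n) powr \<gamma>"
      have D: "?D = ?s * 2 powr (\<gamma> * real n)"
        by (simp add: powr_mult powr_powr mult.commute flip: powr_realpow)
      have "ennreal (real (card ?F) * (1 / ?D)) = (\<Sum>x\<in>?F. ennreal (1 / ?D))"
        by (subst ennreal_mult) (auto simp: ennreal_of_nat_eq_real_of_nat)
      also have "\<dots> \<le> (\<Sum>x\<in>?F. ?h x \<omega>)"
      proof (rule sum_mono)
        fix x assume x: "x \<in> ?F"
        then have pos: "0 < eucl_norm x" using eucl_norm_ge_1[of x] by auto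
        have "eucl_norm x powr \<gamma> \<le> ?D"
          using x \<gamma> pos by (intro powr_mono2 eucl_norm_le_of_in_cubeV) auto
        then have "1 / ?D \<le> 1 / eucl_norm x powr \<gamma>"
          using pos by (intro divide_left_mono mult_pos_pos) auto
        moreover have "\<omega> \<in> hit x" using x elim by (simp add: hit_def)
        ultimately show "ennreal (1 / ?D) \<le> ?h x \<omega>"
          using pos by (simp add: divide_ennreal ennreal_leI flip: ennreal_1)
      qed
      also have "\<dots> = (\<integral>\<^sup>+ x. ?h x \<omega> * indicator ?F x \<partial>?N)"
        by (subst nn_integral_count_space'[of ?F]) auto
      also have "\<dots> \<le> W \<omega>"
        unfolding W_def by (intro nn_integral_mono) (auto simp: indicator_def)
      finally have "real (card ?F) * (1 / ?D) \<le> w"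
        using w by (simp add: ennreal_le_iff)
      then have "real (card ?F) \<le> w * ?D"
        by (simp add: field_simps)
      moreover have "card (range_walk \<xi> \<omega> \<inter> cubeV n) \<le> card ?F + 1"
      proof -
        have "card (range_walk \<xi> \<omega> \<inter> cubeV n) \<le> card (insert 0 ?F)"
          by (intro card_mono) auto
        also have "\<dots> = card ?F + 1" by (subst card_insert_disjoint) auto
        finally show ?thesis .
      qed
      ultimately have "real (card (range_walk \<xi> \<omega> \<inter> cubeV n)) \<le> 1 + w * ?D" by linarith
      also have "\<dots> \<le> 2 powr (\<gamma> * real n) + w * ?D"
        using \<gamma> by (simp add: ge_one_powr_ge_zero)
      finally show ?thesis unfolding D by (simp add: algebra_simps)
    qed
    then show ?case
      using \<gamma> w by (intro upper_mink_dim_leI[of "1 + w * ?s"]) auto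
  qed
qed

text \<open>Both bounds are proved up to \<open>1 / real (Suc k)\<close>, so that only countably
  many null sets are discarded before \<open>k\<close> tends to infinity.\<close>

lemma AE_dim_eq_gamma_c:
  "AE \<omega> in M. upper_mink_dim (range_walk \<xi> \<omega>) = ereal (gamma_c M \<xi>)"
proof -
  let ?I = "\<lambda>\<gamma>. \<integral>\<^sup>+ x. green0 M \<xi> x / ennreal (eucl_norm x powr \<gamma>) \<partial>count_space (UNIV - {0})"
  define S where "S = {\<gamma>::real. 0 < \<gamma> \<and> \<gamma> < real CARD('d) \<and> ?I \<gamma> < \<top>}"
  define g where "g = gamma_c M \<xi>"
  have g: "g = (if S = {} then real CARD('d) else Inf S)"
    unfolding g_def gamma_c_def S_def Let_def ..
  have bdd: "bdd_below S" by (intro bdd_belowI[of _ 0]) (auto simp: S_def)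
  let ?dim = "\<lambda>\<omega>. upper_mink_dim (range_walk \<xi> \<omega>)"
  have le: "AE \<omega> in M. ?dim \<omega> \<le> ereal (g + 1 / real (Suc k))" for k
  proof (cases "S = {}")
    case True
    have "?dim \<omega> \<le> ereal (g + 1 / real (Suc k))" for \<omega>
      using upper_mink_dim_le_CARD by (rule order_trans) (simp add: g True)
    then show ?thesis by simp
  next
    case False
    then obtain \<gamma> where \<gamma>: "\<gamma> \<in> S" "\<gamma> < g + 1 / real (Suc k)"
      using cInf_lessD[of S "g + 1 / real (Suc k)"] by (auto simp: g)
    then have "AE \<omega> in M. ?dim \<omega> \<le> ereal \<gamma>"
      by (intro AE_dim_le) (auto simp: S_def)
    then show ?thesis
    proof eventually_elim
      case (elim \<omega>)
      then show ?case by (rule order_trans) (use \<gamma> in simp)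
    qed
  qed
  have ge: "AE \<omega> in M. ereal (g - 1 / real (Suc k)) \<le> ?dim \<omega>" for k
  proof (cases "g - 1 / real (Suc k) \<le> 0")
    case True
    then have "ereal (g - 1 / real (Suc k)) \<le> ?dim \<omega>" for \<omega>
      by (intro order_trans[OF _ upper_mink_dim_nonneg]) simp
    then show ?thesis by simp
  next
    case False
    define \<gamma>' where "\<gamma>' = g - 1 / real (Suc k)"
    have "\<gamma>' < g" "0 < \<gamma>'" using False by (auto simp: \<gamma>'_def)
    \<comment> \<open>Two intermediate exponents: the series diverges at \<open>\<beta>\<close>,
      which forces growth of the Green mass at rate \<open>\<gamma>\<close>, and the gap from
      \<open>\<gamma>\<close> to \<open>\<gamma>'\<close> absorbs constants.\<close>
    define \<gamma> where "\<gamma> = (2 * \<gamma>' + g) / 3"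
    define \<beta> where "\<beta> = (\<gamma>' + 2 * g) / 3"
    have ord: "0 < \<gamma>'" "\<gamma>' < \<gamma>" "\<gamma> < \<beta>" "\<beta> < g"
      using \<open>\<gamma>' < g\<close> \<open>0 < \<gamma>'\<close> by (auto simp: \<gamma>_def \<beta>_def)
    have "\<beta> \<notin> S" using ord cInf_lower[OF _ bdd, of \<beta>] by (auto simp: g split: if_splits)
    \<comment> \<open>Since \<open>\<beta>\<close> lies in the admissible interval, its absence from
      \<open>S\<close> can only mean divergence of the series.\<close>
    moreover have "\<beta> < real CARD('d)"
    proof (cases "S = {}")
      case False
      then obtain s where "s \<in> S" by blast
      then have "g \<le> s" "s < real CARD('d)" using cInf_lower[OF _ bdd, of s] by (auto simp: g S_def)
      then show ?thesis using ord by linarith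
    qed (use ord in \<open>simp add: g\<close>)
    ultimately have "\<not> ?I \<beta> < \<top>" using ord by (simp add: S_def)
    then have "\<not> eventually (\<lambda>n. green_cube n < 2 powr (\<gamma> * real n)) sequentially"
      using green_series_finite[of \<beta> \<gamma>] ord by auto
    then have "frequently (\<lambda>n. 2 powr (\<gamma> * real n) \<le> green_cube n) sequentially"
      by (simp add: frequently_def not_le)
    from AE_dim_ge[OF ord(2) this] show ?thesis by (simp only: \<gamma>'_def)
  qed
  have "AE \<omega> in M. \<forall>k. ?dim \<omega> \<le> ereal (g + 1 / real (Suc k)) \<and> ereal (g - 1 / real (Suc k)) \<le> ?dim \<omega>"
    using le ge by (simp add: AE_all_countable)
  then show ?thesis
  proof eventually_elim
    case (elim \<omega>)
    have "(\<lambda>k. ereal (g + 1 / real (Suc k))) \<longlonglongrightarrow> ereal g"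
      by (simp, real_asymp)
    then have "?dim \<omega> \<le> ereal g"
      by (rule LIMSEQ_le_const) (use elim in auto)
    have "(\<lambda>k. ereal (g - 1 / real (Suc k))) \<longlonglongrightarrow> ereal g"
      by (simp, real_asymp)
    then have "ereal g \<le> ?dim \<omega>"
      by (rule LIMSEQ_le_const2) (use elim in auto)
    with \<open>?dim \<omega> \<le> ereal g\<close> show ?case unfolding g_def by (rule antisym)
  qed
qed

end

theorem theorem6p1:
  fixes M :: "'w measure" and \<xi> :: "nat \<Rightarrow> 'w \<Rightarrow> int ^ 'd"
  assumes "prob_space M"
    and "\<And>i. \<xi> i \<in> measurable M (count_space UNIV)"
    and "prob_space.indep_vars M (\<lambda>_. count_space UNIV) \<xi> UNIV"
    and "\<And>i. distr M (count_space UNIV) (\<xi> i) = distr M (count_space UNIV) (\<xi> 0)"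
    and transient: "\<And>x. green0 M \<xi> x < \<top>"
  shows "AE \<omega> in M. upper_mink_dim (range_walk \<xi> \<omega>) = ereal (gamma_c M \<xi>)"
proof -
  interpret prob_space M by fact
  interpret transient_random_walk M \<xi>
    by standard (fact assms)+
  show ?thesis by (rule AE_dim_eq_gamma_c)
qed

end
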